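(* The parameters $\lambda_n^\nu$, $\nu\in\{\alpha,\beta,\gamma\}$ (with $\lambda_n=\lambda_n^\gamma$), satisfy for all $n\ge1$: If $\gamma_n=\alpha_n$ and $\gamma_{n-1}=\alpha_{n-1}$ then $\lambda_n=\lambda_n^\alpha=\overline{\lambda_n^\beta}\in\mathbb D$. If $\gamma_n=\beta_n$ and $\gamma_{n-1}=\beta_{n-1}$ then $\lambda_n=\lambda_n^\beta=\overline{\lambda_n^\alpha}\in\mathbb D$. If $\gamma_n=\alpha_n$ and $\gamma_{n-1}=\beta_{n-1}$ then $\lambda_n=1/\overline{\lambda_n^\beta}=1/\lambda_n^\alpha\in\mathbb E$. If $\gamma_n=\beta_n$ and $\gamma_{n-1}=\alpha_{n-1}$ then $\lambda_n=1/\overline{\lambda_n^\alpha}=1/\lambda_n^\beta\in\mathbb E$.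
   Context: Notation: $\mathbb D$ is the open unit disk, $\mathbb T$ the unit circle, $\hat{\mathbb C}=\mathbb C\cup\{\infty\}$, $\mathbb E=\hat{\mathbb C}\setminus(\mathbb D\cup\mathbb T)$ (so $\infty\in\mathbb E$), $1/0=\infty$, $f_*(z)=\overline{f(1/\overline z)}$. Poles. $(\alpha_j)_{j\ge1}$ is an arbitrary sequence in $\mathbb D$, $\beta_j=1/\overline{\alpha}_j$ ($\beta_j=\infty$ if $\alpha_j=0$), $\alpha_0=0$, $\beta_0=\infty$. $(\gamma_j)_{j\ge0}$ is a sequence with $\gamma_j\in\{\alpha_j,\beta_j\}$ for each $j$, chosen arbitrarily. Put $\mathbb a_n=\{1\le j\le n:\gamma_j=\alpha_j\}$, $\mathbb b_n=\{1\le j\le n:\gamma_j=\beta_j\}$. Let $\sigma_j=\overline{\alpha}_j/|\alpha_j|$ if $\alpha_j\neq0$, $\sigma_j=1$ if $\alpha_j=0$; $\varsigma_n=\prod_{j=1}^n\sigma_j$ for $n\ge1$, $\varsigma_0=\varsigma_{-1}=1$. For $\nu\in\{\alpha,\beta,\gamma\}$ let $\varpi_j^\nu(z)=1-\overline{\nu}_jz$ and $\varpi_j^{\nu*}(z)=z-\nu_j$ if $\nu_j\ne\infty$, and $\varpi_j^\nu(z)=-z$, $\varpi_j^{\nu*}(z)=-1$ if $\nu_j=\infty$; $\zeta_j^\nu=\sigma_j\varpi_j^{\nu*}/\varpi_j^\nu$; $\pi_n^\nu=\prod_{j=1}^n\varpi_j^\nu$. The superscript $\gamma$ is often omitted. Spaces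 (empty products are $1$). $B_n^\nu=\prod_{j=1}^n\zeta_j^\nu$ for $\nu\in\{\alpha,\beta\}$; $\dot B_n^\alpha=\prod_{j\in\mathbb a_n}\zeta_j^\alpha$, $\dot B_n^\beta=\prod_{j\in\mathbb b_n}\zeta_j^\beta$; $B_0=1$, and $B_n=B_n^\gamma=\dot B_n^\alpha$ if $\gamma_n=\alpha_n$, $=\dot B_n^\beta$ if $\gamma_n=\beta_n$. $\mathcal L_n^\nu=\mathrm{span}\{B_0^\nu,\dots,B_n^\nu\}$ for $\nu\in\{\alpha,\beta,\gamma\}$. Orthonormal functions. $\mu$ is a probability measure positive a.e. on $\mathbb T$, $\langle f,g\rangle=\int_{\mathbb T}\overline f g\,d\mu$. $\phi_0^\nu=1$; for $n\ge1$, $\phi_n^\nu\in\mathcal L_n^\nu\setminus\mathcal L_{n-1}^\nu$, $\phi_n^\nu\perp\mathcal L_{n-1}^\nu$, $\|\phi_n^\nu\|=1$. Reciprocals: $\phi_n^{\nu*}=B_n^\nu(\phi_n^\nu)_*$ for $\nu\in\{\alpha,\beta\}$, and $\phi_n^*=\dot B_n^\alpha\dot B_n^\beta(\phi_n)_*$. Normalization: $\phi_n^{\alpha*}(\alpha_n)>0$, $\phi_n^{\beta*}(\beta_n)>0$, and $(\phi_n^*/\dot B_n^\beta)(\alpha_n)>0$ if $\gamma_n=\alpha_n$, $(\phi_n^*/\dot B_n^\alpha)(\beta_n)>0$ if $\gamma_n=\beta_n$. Parameters. $p_n^\nu=\phi_n^\nu\pi_n^\nu$ is a polynomial of degree at most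 $n$, $p_n^{\nu*}(z)=z^n\overline{p_n^\nu(1/\overline z)}$; evaluating $p_n^\nu$ or $p_n^{\nu*}$ at $\infty$ means taking the coefficient of $z^n$. Then $$\lambda_n^\nu=\eta_n^\nu\frac{p_n^\nu(\nu_{n-1})}{\overline{p_n^{\nu*}(\nu_{n-1})}},\qquad \eta_n^\nu=\overline{\varsigma}_{n-2}\frac{\overline{p_{n-1}^{\nu*}(\nu_{n-1})}}{p_{n-1}^{\nu*}(\nu_{n-1})},$$ with $\lambda_n^\gamma=\infty$ when $p_n^{*}(\gamma_{n-1})=0$. *)

theory Defs
  imports
    "HOL-Probability.Probability_Measure"
    "HOL-Computational_Algebra.Polynomial"
begin

section \<open>The extended complex plane\<close>

datatype ecomplex = Fin complex | Infty

fun ecnj :: "ecomplex \<Rightarrow> ecomplex" where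
  "ecnj (Fin z) = Fin (cnj z)"
| "ecnj Infty = Infty"

fun einverse :: "ecomplex \<Rightarrow> ecomplex" where
  "einverse (Fin z) = (if z = 0 then Infty else Fin (inverse z))"
| "einverse Infty = Fin 0"

definition unit_disk :: "ecomplex set" where
  "unit_disk = Fin ` ball 0 1"

definition unit_circle :: "ecomplex set" where
  "unit_circle = Fin ` sphere 0 1"

definition exterior_disk :: "ecomplex set" where
  "exterior_disk = UNIV - (unit_disk \<union> unit_circle)"

fun punctured_nhds :: "ecomplex \<Rightarrow> complex filter" where
  "punctured_nhds (Fin a) = at a"
| "punctured_nhds Infty = at_infinity"

text \<open>
  Rational functions are ordinary functions on the complex plane; at a pole, or at a removable
  singularity of the defining formula, such a function takes the value prescribed by
  \<open>x / 0 = 0\<close>. No pole lies on the unit circle, and a rational function is determined by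
  its values there. The value of a rational function at a point is therefore taken to be its
  limit at that point, so that removable singularities and the point at infinity are treated
  correctly.
\<close>

definition positive_value_at :: "(complex \<Rightarrow> complex) \<Rightarrow> ecomplex \<Rightarrow> bool" where
  "positive_value_at f w \<longleftrightarrow> (\<exists>r::real. r > 0 \<and> (f \<longlongrightarrow> complex_of_real r) (punctured_nhds w))"

definition substar :: "(complex \<Rightarrow> complex) \<Rightarrow> complex \<Rightarrow> complex" where
  "substar f z = cnj (f (1 / cnj z))"


section \<open>Poles and Blaschke products\<close>

definition alpha_poles :: "(nat \<Rightarrow> complex) \<Rightarrow> nat \<Rightarrow> ecomplex" where
  "alpha_poles \<alpha> j = Fin (\<alpha> j)"

definition beta_poles :: "(nat \<Rightarrow> complex) \<Rightarrow> nat \<Rightarrow> ecomplex" where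
  "beta_poles \<alpha> j = einverse (ecnj (Fin (\<alpha> j)))"

definition sigma :: "(nat \<Rightarrow> complex) \<Rightarrow> nat \<Rightarrow> complex" where
  "sigma \<alpha> j = (if \<alpha> j = 0 then 1 else cnj (\<alpha> j) / complex_of_real (cmod (\<alpha> j)))"

definition varsigma :: "(nat \<Rightarrow> complex) \<Rightarrow> nat \<Rightarrow> complex" where
  "varsigma \<alpha> n = (\<Prod>j=1..n. sigma \<alpha> j)"

fun varpi :: "ecomplex \<Rightarrow> complex \<Rightarrow> complex" where
  "varpi (Fin v) z = 1 - cnj v * z"
| "varpi Infty z = - z"

fun varpi_star :: "ecomplex \<Rightarrow> complex \<Rightarrow> complex" where
  "varpi_star (Fin v) z = z - v"
| "varpi_star Infty z = - 1"

definition zeta :: "(nat \<Rightarrow> complex) \<Rightarrow> (nat \<Rightarrow> ecomplex) \<Rightarrow> nat \<Rightarrow> complex \<Rightarrow> complex" where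
  "zeta \<alpha> \<nu> j z = sigma \<alpha> j * varpi_star (\<nu> j) z / varpi (\<nu> j) z"

definition blaschke :: "(nat \<Rightarrow> complex) \<Rightarrow> (nat \<Rightarrow> ecomplex) \<Rightarrow> nat \<Rightarrow> complex \<Rightarrow> complex" where
  "blaschke \<alpha> \<nu> n z = (\<Prod>j=1..n. zeta \<alpha> \<nu> j z)"

text \<open>
  With \<open>\<nu> = alpha_poles \<alpha>\<close> or \<open>\<nu> = beta_poles \<alpha>\<close> these are the
  dotted products \<open>\<dot>B\<close> with superscript alpha or beta: only the factors with
  \<open>\<gamma> j = \<nu> j\<close> are kept.
\<close>

definition blaschke_dot ::
  "(nat \<Rightarrow> complex) \<Rightarrow> (nat \<Rightarrow> ecomplex) \<Rightarrow> (nat \<Rightarrow> ecomplex) \<Rightarrow> nat \<Rightarrow> complex \<Rightarrow> complex" where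
  "blaschke_dot \<alpha> \<gamma> \<nu> n z = (\<Prod>j | 1 \<le> j \<and> j \<le> n \<and> \<gamma> j = \<nu> j. zeta \<alpha> \<nu> j z)"

definition blaschke_gamma ::
  "(nat \<Rightarrow> complex) \<Rightarrow> (nat \<Rightarrow> ecomplex) \<Rightarrow> nat \<Rightarrow> complex \<Rightarrow> complex" where
  "blaschke_gamma \<alpha> \<gamma> n =
     (if \<gamma> n = alpha_poles \<alpha> n then blaschke_dot \<alpha> \<gamma> (alpha_poles \<alpha>) n
      else blaschke_dot \<alpha> \<gamma> (beta_poles \<alpha>) n)"

definition lspace :: "(nat \<Rightarrow> complex \<Rightarrow> complex) \<Rightarrow> nat \<Rightarrow> (complex \<Rightarrow> complex) set" where
  "lspace B n = {f. \<exists>c :: nat \<Rightarrow> complex. f = (\<lambda>z. \<Sum>k\<le>n. c k * B k z)}"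


section \<open>The measure and the orthonormal functions\<close>

definition circle_measure :: "complex measure" where
  "circle_measure =
     distr (uniform_measure lborel {0..2*pi}) (restrict_space borel (sphere 0 1)) cis"

text \<open>
  \<open>\<mu>\<close> is a probability measure on the unit circle that is positive almost everywhere:
  in its Lebesgue decomposition with respect to arc length, the density \<open>w\<close> of the
  absolutely continuous part is positive almost everywhere.
\<close>

definition positive_ae_prob_on_circle :: "complex measure \<Rightarrow> bool" where
  "positive_ae_prob_on_circle \<mu> \<longleftrightarrow>
     prob_space \<mu> \<and> sets \<mu> = sets (restrict_space borel (sphere 0 1)) \<and>
     (\<exists>w \<in> borel_measurable circle_measure. \<exists>\<mu>s :: complex measure.
        sets \<mu>s = sets \<mu> \<and>
        (\<forall>A\<in>sets \<mu>. emeasure \<mu> A = emeasure (density circle_measure w) A + emeasure \<mu>s A) \<and>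
        (\<exists>N\<in>sets \<mu>. emeasure circle_measure N = 0 \<and> emeasure \<mu>s (space \<mu> - N) = 0) \<and>
        (AE z in circle_measure. w z > (0::ennreal)))"

definition inner_prod ::
  "complex measure \<Rightarrow> (complex \<Rightarrow> complex) \<Rightarrow> (complex \<Rightarrow> complex) \<Rightarrow> complex" where
  "inner_prod \<mu> f g = (LINT z|\<mu>. cnj (f z) * g z)"

definition norm_fun :: "complex measure \<Rightarrow> (complex \<Rightarrow> complex) \<Rightarrow> real" where
  "norm_fun \<mu> f = sqrt (Re (inner_prod \<mu> f f))"

definition orthonormal_functions ::
  "complex measure \<Rightarrow> (nat \<Rightarrow> complex \<Rightarrow> complex) \<Rightarrow> (nat \<Rightarrow> complex \<Rightarrow> complex) \<Rightarrow> bool" where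
  "orthonormal_functions \<mu> B \<phi> \<longleftrightarrow>
     \<phi> 0 = (\<lambda>z. 1) \<and>
     (\<forall>n\<ge>1. \<phi> n \<in> lspace B n - lspace B (n - 1) \<and>
             (\<forall>f \<in> lspace B (n - 1). inner_prod \<mu> f (\<phi> n) = 0) \<and>
             norm_fun \<mu> (\<phi> n) = 1)"

text \<open>Used for \<open>\<nu> = alpha_poles \<alpha>\<close> and \<open>\<nu> = beta_poles \<alpha>\<close>.\<close>

definition orf ::
  "complex measure \<Rightarrow> (nat \<Rightarrow> complex) \<Rightarrow> (nat \<Rightarrow> ecomplex) \<Rightarrow> (nat \<Rightarrow> complex \<Rightarrow> complex) \<Rightarrow> bool" where
  "orf \<mu> \<alpha> \<nu> \<phi> \<longleftrightarrow>
     orthonormal_functions \<mu> (blaschke \<alpha> \<nu>) \<phi> \<and>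
     (\<forall>n\<ge>1. positive_value_at (\<lambda>z. blaschke \<alpha> \<nu> n z * substar (\<phi> n) z) (\<nu> n))"

definition recip_gamma ::
  "(nat \<Rightarrow> complex) \<Rightarrow> (nat \<Rightarrow> ecomplex) \<Rightarrow> (nat \<Rightarrow> complex \<Rightarrow> complex) \<Rightarrow> nat \<Rightarrow> complex \<Rightarrow> complex" where
  "recip_gamma \<alpha> \<gamma> \<phi> n z =
     blaschke_dot \<alpha> \<gamma> (alpha_poles \<alpha>) n z * blaschke_dot \<alpha> \<gamma> (beta_poles \<alpha>) n z
       * substar (\<phi> n) z"

definition orf_gamma ::
  "complex measure \<Rightarrow> (nat \<Rightarrow> complex) \<Rightarrow> (nat \<Rightarrow> ecomplex) \<Rightarrow> (nat \<Rightarrow> complex \<Rightarrow> complex) \<Rightarrow> bool" where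
  "orf_gamma \<mu> \<alpha> \<gamma> \<phi> \<longleftrightarrow>
     orthonormal_functions \<mu> (blaschke_gamma \<alpha> \<gamma>) \<phi> \<and>
     (\<forall>n\<ge>1.
        (\<gamma> n = alpha_poles \<alpha> n \<longrightarrow>
           positive_value_at
             (\<lambda>z. recip_gamma \<alpha> \<gamma> \<phi> n z / blaschke_dot \<alpha> \<gamma> (beta_poles \<alpha>) n z)
             (alpha_poles \<alpha> n)) \<and>
        (\<gamma> n = beta_poles \<alpha> n \<longrightarrow>
           positive_value_at
             (\<lambda>z. recip_gamma \<alpha> \<gamma> \<phi> n z / blaschke_dot \<alpha> \<gamma> (alpha_poles \<alpha>) n z)
             (beta_poles \<alpha> n)))"


section \<open>The parameters\<close>

text \<open>
  The polynomial that agrees with \<open>\<phi>\<^sub>n \<pi>\<^sub>n\<close>; it is pinned down on the unit circle, where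
  no denominator vanishes.
\<close>

definition numer_poly ::
  "(nat \<Rightarrow> ecomplex) \<Rightarrow> (nat \<Rightarrow> complex \<Rightarrow> complex) \<Rightarrow> nat \<Rightarrow> complex poly" where
  "numer_poly \<nu> \<phi> n =
     (THE p. \<forall>z\<in>sphere 0 1. poly p z = \<phi> n z * (\<Prod>j=1..n. varpi (\<nu> j) z))"

definition poly_star :: "nat \<Rightarrow> complex poly \<Rightarrow> complex poly" where
  "poly_star n p = (\<Sum>k\<le>n. monom (cnj (coeff p (n - k))) k)"

lemma poly_poly_star:
  assumes "degree p \<le> n" "z \<noteq> 0"
  shows "poly (poly_star n p) z = z ^ n * cnj (poly p (1 / cnj z))"
proof -
  have "poly p (1 / cnj z) = (\<Sum>i\<le>n. coeff p i * (1 / cnj z) ^ i)"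
    unfolding poly_altdef using assms(1)
    by (intro sum.mono_neutral_left) (auto simp: coeff_eq_0)
  then have "z ^ n * cnj (poly p (1 / cnj z)) = (\<Sum>i\<le>n. cnj (coeff p i) * (z ^ n / z ^ i))"
    by (simp add: sum_distrib_left power_divide mult_ac)
  also have "\<dots> = (\<Sum>i\<le>n. cnj (coeff p i) * z ^ (n - i))"
    using assms(2) by (intro sum.cong) (auto simp: power_diff)
  also have "\<dots> = (\<Sum>k\<le>n. cnj (coeff p (n - k)) * z ^ k)"
    by (rule sum.reindex_bij_witness[of _ "\<lambda>k. n - k" "\<lambda>k. n - k"]) auto
  finally show ?thesis
    by (simp add: poly_star_def poly_sum poly_monom)
qed

text \<open>Evaluation of a polynomial regarded as having formal degree \<open>n\<close>.\<close>

fun poly_at :: "nat \<Rightarrow> complex poly \<Rightarrow> ecomplex \<Rightarrow> complex" where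
  "poly_at n p (Fin w) = poly p w"
| "poly_at n p Infty = coeff p n"

text \<open>
  For \<open>n = 1\<close> the truncated subtraction gives \<open>varsigma \<alpha> 0 = 1\<close>, which is the
  convention for index \<open>-1\<close>.
\<close>

definition eta_param ::
  "(nat \<Rightarrow> complex) \<Rightarrow> (nat \<Rightarrow> ecomplex) \<Rightarrow> (nat \<Rightarrow> complex \<Rightarrow> complex) \<Rightarrow> nat \<Rightarrow> complex" where
  "eta_param \<alpha> \<nu> \<phi> n =
     (let q = poly_at (n - 1) (poly_star (n - 1) (numer_poly \<nu> \<phi> (n - 1))) (\<nu> (n - 1))
      in cnj (varsigma \<alpha> (n - 2)) * (cnj q / q))"

text \<open>
  The value infinity can only occur for \<open>\<nu> = \<gamma>\<close>: for the pure alpha and beta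
  sequences the denominator does not vanish.
\<close>

definition lambda_param ::
  "(nat \<Rightarrow> complex) \<Rightarrow> (nat \<Rightarrow> ecomplex) \<Rightarrow> (nat \<Rightarrow> complex \<Rightarrow> complex) \<Rightarrow> nat \<Rightarrow> ecomplex" where
  "lambda_param \<alpha> \<nu> \<phi> n =
     (let p = numer_poly \<nu> \<phi> n;
          d = poly_at n (poly_star n p) (\<nu> (n - 1))
      in if d = 0 then Infty
         else Fin (eta_param \<alpha> \<nu> \<phi> n * (poly_at n p (\<nu> (n - 1)) / cnj d)))"

end

theory Submission
  imports Defs "HOL-Computational_Algebra.Fundamental_Theorem_Algebra"
begin

text \<open>
  Clearing denominators turns the three families of orthonormal functions into polynomials of
  degree at most \<open>n\<close>, and turns the scalar product of the numerators into integration against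
  the same positive weight \<open>d\<mu> / |\<pi>\<^sub>n|\<^sup>2\<close>, with \<open>\<pi>\<^sub>n\<close> the product of the factors \<open>1 - cnj (\<alpha> j) z\<close>,
  \<open>j \<le> n\<close>: choosing \<open>\<beta> j\<close> in place of \<open>\<alpha> j\<close> replaces the factor \<open>1 - cnj (\<alpha> j) z\<close> by a constant
  multiple of \<open>z - \<alpha> j\<close>, which has the same modulus on the circle up to that constant. In this
  weighted space there is a single distinguished polynomial \<open>H\<^sub>n\<close>: the unit vector orthogonal to
  all polynomials of degree at most \<open>n\<close> that vanish at \<open>\<alpha> n\<close>, normalized by a phase condition at
  \<open>\<alpha> n\<close>. It is the normalized reproducing kernel of the point \<open>\<alpha> n\<close> and depends on \<open>\<mu>\<close> and
  \<open>\<alpha>\<close> only.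

  Orthogonality of \<open>\<phi> n\<close> to the preceding space then says that its numerator \<open>p\<close> is \<open>s H\<^sub>n\<close> when
  \<open>\<gamma> n = \<beta> n\<close> and \<open>s \<varsigma>\<^sub>n\<close> times the reversed polynomial of \<open>H\<^sub>n\<close> when \<open>\<gamma> n = \<alpha> n\<close>, with a nonzero
  \<^emph>\<open>real\<close> constant \<open>s\<close> (lemmas \<open>numer_poly_beta\<close> and \<open>numer_poly_alpha\<close>). Being real, \<open>s\<close> cancels in the
  parameter. Passing from \<open>\<gamma> n = \<alpha> n\<close> to \<open>\<gamma> n = \<beta> n\<close> exchanges the numerator with its reversal, and
  so does passing from evaluation at \<open>\<alpha> (n - 1)\<close> to evaluation at \<open>\<beta> (n - 1)\<close>, up to conjugation and a
  power of \<open>\<beta> (n - 1)\<close>. Each exchange inverts the quotient that defines the parameter, up to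
  conjugation and phase; what remains is
  the bookkeeping of unimodular factors, done in \<open>lambda_param_cases\<close>. It expresses every parameter
  through one complex number built from \<open>H\<^sub>n\<^sub>-\<^sub>1\<close> and \<open>H\<^sub>n\<close>. The pure \<open>\<alpha>\<close> and \<open>\<beta>\<close> families are the instances
  \<open>\<gamma> = \<alpha>\<close> and \<open>\<gamma> = \<beta>\<close> of the mixed one, so comparing the parameters is comparing the values
  of this one number.

  That the number has modulus less than \<open>1\<close> rests on the location of zeros. Orthogonality forces
  every zero of \<open>H\<^sub>n\<close> outside the closed disk (\<open>szego_kernel_root_outside\<close>); factor by factor, the reversal of
  such a polynomial is smaller than the polynomial itself at every point of the open disk
  (\<open>norm_reversed_le\<close>).
\<close>

section \<open>Reversed polynomials\<close>

lemma inj_on_cis: "inj_on cis {0..<2*pi}"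
proof (rule inj_onI)
  fix x y :: real assume xy: "x \<in> {0..<2*pi}" "y \<in> {0..<2*pi}" "cis x = cis y"
  then have "sin x = sin y \<and> cos x = cos y" by (auto simp: complex_eq_iff)
  then obtain n :: int where n: "x = y + 2 * of_int n * pi"
    unfolding sin_cos_eq_iff by (auto simp: mult_ac)
  have "\<bar>2 * real_of_int n * pi\<bar> < 2 * pi" using n xy by auto
  then have "\<bar>real_of_int n\<bar> < 1" by (simp add: abs_mult)
  then show "x = y" using n by auto
qed

lemma infinite_unit_circle: "infinite (sphere (0::complex) 1)"
proof
  assume fin: "finite (sphere (0::complex) 1)"
  have "inj_on cis {0..<2*pi}" by (rule inj_on_cis)
  moreover have "cis ` {0..<2*pi} \<subseteq> sphere 0 1" by auto
  ultimately have "finite {0..<2*pi}" using fin finite_subset finite_imageD by blast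
  then show False by (simp add: infinite_Ico)
qed

lemma poly_eqI_unit_circle:
  fixes p q :: "complex poly"
  assumes "\<And>z. z \<in> sphere 0 1 \<Longrightarrow> poly p z = poly q z"
  shows "p = q"
proof (rule ccontr)
  assume "p \<noteq> q"
  then have "finite {z. poly (p - q) z = 0}" by (intro poly_roots_finite) auto
  moreover have "sphere 0 1 \<subseteq> {z. poly (p - q) z = 0}" using assms by auto
  ultimately show False using infinite_unit_circle finite_subset by blast
qed

lemma coeff_poly_star: "coeff (poly_star n p) k = (if k \<le> n then cnj (coeff p (n - k)) else 0)"
  by (simp add: poly_star_def coeff_sum sum.delta' if_distrib cong: if_cong)

lemma degree_poly_star: "degree (poly_star n p) \<le> n"
  by (rule degree_le) (simp add: coeff_poly_star)

lemma poly_star_poly_star: "degree p \<le> n \<Longrightarrow> poly_star n (poly_star n p) = p"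
  by (rule poly_eqI) (simp add: coeff_poly_star coeff_eq_0)

lemma poly_star_smult: "poly_star n (smult c p) = smult (cnj c) (poly_star n p)"
  by (rule poly_eqI) (simp add: coeff_poly_star)

lemma inverse_cnj_unit: "cmod z = 1 \<Longrightarrow> 1 / cnj z = z"
  by (metis complex_div_cnj complex_norm_square divide_self_if mult.commute nonzero_mult_div_cancel_left
      norm_zero of_real_1 power_one zero_neq_one complex_cnj_zero_iff)

lemma poly_poly_star_unit:
  assumes "degree p \<le> n" "cmod z = 1"
  shows "poly (poly_star n p) z = z ^ n * cnj (poly p z)"
proof -
  have "z \<noteq> 0" using assms(2) by auto
  with poly_poly_star[OF assms(1) this] show ?thesis using inverse_cnj_unit[OF assms(2)] by simp
qed

lemma norm_poly_poly_star_unit: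
  assumes "degree p \<le> n" "cmod z = 1"
  shows "cmod (poly (poly_star n p) z) = cmod (poly p z)"
  using assms by (simp add: poly_poly_star_unit norm_mult norm_power)

lemma poly_star_root_mult:
  assumes "degree q \<le> n"
  shows "poly_star (Suc n) ([:- w, 1:] * q) = [:1, - cnj w:] * poly_star n q"
proof (rule poly_eqI_unit_circle)
  fix z :: complex assume "z \<in> sphere 0 1"
  then have z: "cmod z = 1" by simp
  have "z * cnj z = 1" using z by (simp add: complex_norm_square[symmetric])
  moreover have "degree ([:- w, 1:] * q) \<le> Suc n"
    using assms degree_mult_le[of "[:- w, 1:]" q] by simp
  moreover have key: "z ^ Suc n * cnj (poly [:- w, 1:] z * y) = poly [:1, - cnj w:] z * (z ^ n * cnj y)" for y
  proof -
    have "z ^ Suc n * cnj (poly [:- w, 1:] z * y) = z ^ n * cnj y * (z * cnj z - cnj w * z)"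
      by (simp add: algebra_simps)
    then show ?thesis using \<open>z * cnj z = 1\<close> by (simp add: algebra_simps)
  qed
  ultimately show "poly (poly_star (Suc n) ([:- w, 1:] * q)) z = poly ([:1, - cnj w:] * poly_star n q) z"
    unfolding poly_mult using assms z by (simp only: poly_poly_star_unit poly_mult flip: key)
qed

lemma linear_factor_obtain:
  fixes p :: "complex poly"
  assumes "degree p \<le> Suc n" "poly p w = 0"
  obtains q where "degree q \<le> n" "p = [:- w, 1:] * q"
proof -
  obtain q where q: "p = [:- w, 1:] * q" using assms(2) by (auto simp: poly_eq_0_iff_dvd dvd_def)
  have "degree q \<le> n"
  proof (cases "q = 0")
    case False
    then have "degree p = 1 + degree q" unfolding q by (subst degree_mult_eq) auto
    then show ?thesis using assms(1) by simp
  qed simp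
  then show thesis using q that by blast
qed

text \<open>
  The zero of \<open>1 - cnj w z\<close> may lie at infinity (\<open>w = 0\<close>), where dividing it off means dropping the
  degree. Working with the reversed polynomial covers both cases at once.
\<close>

lemma reversed_factor_obtain:
  fixes p :: "complex poly"
  assumes "degree p \<le> Suc n" "poly (poly_star (Suc n) p) w = 0"
  obtains q where "degree q \<le> n" "p = [:1, - cnj w:] * q"
proof -
  obtain q where q: "degree q \<le> n" "poly_star (Suc n) p = [:- w, 1:] * q"
    using linear_factor_obtain[OF degree_poly_star assms(2)] by blast
  have "p = [:1, - cnj w:] * poly_star n q"
    using poly_star_root_mult[OF q(1)] poly_star_poly_star[OF assms(1)] q(2) by metis
  then show thesis using that degree_poly_star by blast
qed

text \<open>
  The Blaschke factor of the disk in polynomial form: the difference of the squared moduli factors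
  as \<open>(|w|\<^sup>2 - 1) (1 - |a|\<^sup>2)\<close>.
\<close>

lemma norm_linear_less_reversed:
  assumes "cmod a < 1" "cmod w > 1"
  shows "cmod (1 - cnj w * a) < cmod (a - w)"
proof -
  have "(cmod (a - w))\<^sup>2 - (cmod (1 - cnj w * a))\<^sup>2 = ((cmod w)\<^sup>2 - 1) * (1 - (cmod a)\<^sup>2)"
    unfolding cmod_power2 by (simp add: power2_eq_square algebra_simps)
  moreover have "\<dots> > 0" using assms by (intro mult_pos_pos) (auto simp: power_less_one_iff abs_square_less_1)
  ultimately have "(cmod (1 - cnj w * a))\<^sup>2 < (cmod (a - w))\<^sup>2" by linarith
  then show ?thesis by (rule power2_less_imp_less) simp
qed

text \<open>
  Reversal turns each factor \<open>z - w\<close> into \<open>1 - cnj w z\<close>, which is smaller at a point of the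
  disk when \<open>|w| > 1\<close>; a degree deficit contributes powers of \<open>z\<close>, which only help. The
  induction needs the weak inequality, since for \<open>n = 0\<close> there is no factor to make it strict.
\<close>

lemma norm_reversed_le:
  fixes p :: "complex poly"
  assumes "degree p \<le> n" "p \<noteq> 0" "\<And>w. poly p w = 0 \<Longrightarrow> cmod w > 1" "cmod a < 1"
  shows "cmod (poly (poly_star n p) a) \<le> cmod (poly p a) \<and>
    (n \<ge> 1 \<longrightarrow> cmod (poly (poly_star n p) a) < cmod (poly p a))"
  using assms(1-3)
proof (induction n arbitrary: p)
  case 0
  then obtain c where "p = [:c:]" using degree_eq_zeroE by blast
  then have "poly_star 0 p = [:cnj c:]" by (simp add: poly_star_def monom_0)
  then show ?case using \<open>p = [:c:]\<close> by simp
next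
  case (Suc n)
  have pa: "poly p a \<noteq> 0" using Suc.prems(3)[of a] assms(4) by auto
  show ?case
  proof (cases "degree p = 0")
    case True
    then obtain c where c: "p = [:c:]" using degree_eq_zeroE by blast
    \<comment> \<open>A constant regarded as having formal degree \<open>Suc n\<close> reverses to a pure power of \<open>z\<close>.\<close>
    have "poly_star (Suc n) p = monom (cnj c) (Suc n)"
      by (rule poly_eqI) (auto simp: coeff_poly_star c coeff_pCons split: nat.splits)
    then have "cmod (poly (poly_star (Suc n) p) a) = cmod c * cmod a ^ Suc n"
      by (simp add: poly_monom norm_mult norm_power)
    also have "\<dots> \<le> cmod c * cmod a"
      using assms(4) by (intro mult_left_mono) (auto intro!: mult_left_le power_le_one)
    also have "\<dots> < cmod c * 1"
      using pa assms(4) c by (intro mult_strict_left_mono) auto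
    finally show ?thesis using c by simp
  next
    case False
    then obtain w where w: "poly p w = 0"
      using fundamental_theorem_of_algebra[of p] by (auto simp: constant_degree)
    obtain q where q: "degree q \<le> n" "p = [:- w, 1:] * q"
      using linear_factor_obtain[OF Suc.prems(1) w] by blast
    have qa: "poly q a \<noteq> 0" using pa q by auto
    have "cmod (poly (poly_star n q) a) \<le> cmod (poly q a)"
      using Suc.IH[of q] q Suc.prems(3) qa by (metis mult_eq_0_iff poly_0 poly_mult)
    then have "cmod (1 - cnj w * a) * cmod (poly (poly_star n q) a) \<le> cmod (1 - cnj w * a) * cmod (poly q a)"
      by (simp add: mult_left_mono)
    also have "\<dots> < cmod (a - w) * cmod (poly q a)"
      using qa norm_linear_less_reversed[OF assms(4) Suc.prems(3)[OF w]] by simp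
    finally have "cmod (poly (poly_star (Suc n) p) a) < cmod (poly p a)"
      unfolding q(2) poly_star_root_mult[OF q(1)] by (simp add: norm_mult[symmetric] algebra_simps)
    then show ?thesis by simp
  qed
qed

section \<open>Measures on the circle with positive density\<close>

lemma circle_measure_space: "space circle_measure = sphere 0 1" "sets circle_measure = sets (restrict_space borel (sphere 0 1))"
  by (simp_all add: circle_measure_def space_restrict_space)

lemma cis_measurable: "cis \<in> measurable (uniform_measure lborel {0..2*pi}) (restrict_space borel (sphere 0 1))"
proof (rule measurable_restrict_space2)
  have "continuous_on UNIV cis" by (intro continuous_intros)
  then have "cis \<in> borel_measurable borel" by (rule borel_measurable_continuous_onI)
  then show "cis \<in> uniform_measure lborel {0..2*pi} \<rightarrow>\<^sub>M borel"
    by (simp add: measurable_def)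
qed auto

lemma emeasure_circle_finite:
  assumes "finite Z" "Z \<subseteq> sphere 0 1"
  shows "emeasure circle_measure Z = 0"
proof -
  have Zs: "Z \<in> sets (restrict_space borel (sphere 0 1))"
    using assms by (auto simp: sets_restrict_space intro!: image_eqI[of _ _ Z] borel_closed finite_imp_closed)
  let ?P = "cis -` Z \<inter> {0..2*pi}"
  have fin: "finite ?P"
  proof -
    have "?P \<subseteq> insert (2*pi) (cis -` Z \<inter> {0..<2*pi})" by auto
    moreover have "finite (cis -` Z \<inter> {0..<2*pi})"
      by (rule finite_vimage_IntI[OF assms(1) inj_on_cis])
    ultimately show ?thesis using finite_subset by blast
  qed
  have "emeasure circle_measure Z = emeasure (uniform_measure lborel {0..2*pi}) (cis -` Z)"
    unfolding circle_measure_def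
    using emeasure_distr[OF cis_measurable Zs] by simp
  also have "\<dots> = emeasure lborel ({0..2*pi} \<inter> cis -` Z) / emeasure lborel {0..2*pi}"
  proof (rule emeasure_uniform_measure)
    show "cis -` Z \<in> sets lborel"
      using measurable_sets[OF cis_measurable Zs] by simp
  qed simp
  also have "{0..2*pi} \<inter> cis -` Z = ?P" by auto
  also have "emeasure lborel ?P = 0"
    using fin by (intro emeasure_lborel_countable countable_finite)
  finally show ?thesis by simp
qed

lemma circle_measure_total: "emeasure circle_measure (sphere 0 1) = 1"
proof -
  have "sphere (0::complex) 1 \<in> sets (restrict_space borel (sphere 0 1))"
    using sets.top[of "restrict_space borel (sphere (0::complex) 1)"] by (simp add: space_restrict_space)
  then have "emeasure circle_measure (sphere 0 1)
      = emeasure (uniform_measure lborel {0..2*pi}) (cis -` sphere 0 1)"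
    unfolding circle_measure_def using emeasure_distr[OF cis_measurable] by simp
  also have "cis -` sphere 0 1 = UNIV" by auto
  also have "emeasure (uniform_measure lborel {0..2*pi}) UNIV = emeasure lborel {0..2*pi} / emeasure lborel {0..2*pi}"
    by (subst emeasure_uniform_measure) auto
  also have "\<dots> = 1" by (rule ennreal_divide_self) auto
  finally show ?thesis .
qed

text \<open>
  Positivity of \<open>\<mu>\<close> makes the scalar product of polynomials definite, because a nonzero polynomial
  has only finitely many zeros. A finite set carrying \<open>\<mu>\<close> would, because the density of \<open>\<mu>\<close> is positive
  almost everywhere, have a complement of arc length zero.
\<close>

lemma positive_ae_not_supported_on_finite:
  assumes mu: "positive_ae_prob_on_circle \<mu>" and fin: "finite Z"
    and null: "AE z in \<mu>. z \<in> Z"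
  shows False
proof -
  obtain w \<mu>s where w: "w \<in> borel_measurable circle_measure"
    and dec: "\<And>A. A \<in> sets \<mu> \<Longrightarrow> emeasure \<mu> A = emeasure (density circle_measure w) A + emeasure \<mu>s A"
    and pos: "AE z in circle_measure. w z > (0::ennreal)"
    and sets: "sets \<mu> = sets (restrict_space borel (sphere 0 1))"
    using mu unfolding positive_ae_prob_on_circle_def by blast
  have sp: "space \<mu> = sphere 0 1" using sets_eq_imp_space_eq[OF sets] by (simp add: space_restrict_space)
  let ?A = "sphere 0 1 - Z"
  have ZT: "sphere 0 1 \<inter> Z \<in> sets circle_measure"
    using fin by (auto simp: circle_measure_space sets_restrict_space intro!: image_eqI[of _ _ "Z"] borel_closed finite_imp_closed)
  have A: "?A \<in> sets circle_measure"
  proof -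
    have "?A = space circle_measure - (sphere 0 1 \<inter> Z)" by (auto simp: circle_measure_space)
    then show ?thesis using ZT by (metis sets.compl_sets)
  qed
  have A': "?A \<in> sets \<mu>" using A by (simp add: circle_measure_space sets)
  have "emeasure \<mu> ?A = 0"
    using null AE_iff_measurable[OF A', of "\<lambda>z. z \<in> Z"] sp by (auto simp: set_diff_eq)
  then have "emeasure (density circle_measure w) ?A = 0" using dec[OF A'] by simp
  then have "(\<integral>\<^sup>+ z. w z * indicator ?A z \<partial>circle_measure) = 0"
    using emeasure_density[OF w A] by simp
  then have "AE z in circle_measure. w z * indicator ?A z = 0"
    using w A by (subst (asm) nn_integral_0_iff_AE) auto
  with pos have "AE z in circle_measure. z \<notin> ?A"
    by eventually_elim (auto simp: indicator_def)
  then have "emeasure circle_measure ?A = 0"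
    by (subst AE_iff_measurable[OF A, symmetric, of "\<lambda>z. z \<notin> ?A"]) (auto simp: circle_measure_space)
  moreover have "emeasure circle_measure (sphere 0 1 \<inter> Z) = 0"
    using fin by (intro emeasure_circle_finite) auto
  moreover have "emeasure circle_measure (sphere 0 1) \<le> emeasure circle_measure ?A + emeasure circle_measure (sphere 0 1 \<inter> Z)"
  proof -
    have "sphere 0 1 = ?A \<union> (sphere 0 1 \<inter> Z)" by auto
    then show ?thesis using emeasure_subadditive[OF A ZT] by metis
  qed
  ultimately show False by (simp add: circle_measure_total)
qed

section \<open>The weighted inner product and its reproducing kernel\<close>

definition pole_denom :: "(nat \<Rightarrow> complex) \<Rightarrow> nat \<Rightarrow> complex \<Rightarrow> complex" where
  "pole_denom \<alpha> n z = (\<Prod>j=1..n. 1 - cnj (\<alpha> j) * z)"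

definition weighted_inner ::
  "complex measure \<Rightarrow> (nat \<Rightarrow> complex) \<Rightarrow> nat \<Rightarrow> complex poly \<Rightarrow> complex poly \<Rightarrow> complex" where
  "weighted_inner \<mu> \<alpha> n f g =
     (LINT z|\<mu>. cnj (poly f z) * poly g z / complex_of_real ((cmod (pole_denom \<alpha> n z))\<^sup>2))"

text \<open>
  The reproducing kernel at \<open>\<alpha> n\<close> of the polynomials of degree at most \<open>n\<close>, scaled to norm \<open>1\<close>; its
  phase is fixed relative to the denominator, because this is what the normalization of the
  orthonormal functions prescribes. Stating orthogonality through vanishing at \<open>\<alpha> n\<close>
  keeps the definition meaningful for \<open>n = 0\<close>.
\<close>

definition szego_kernel ::
  "complex measure \<Rightarrow> (nat \<Rightarrow> complex) \<Rightarrow> nat \<Rightarrow> complex poly \<Rightarrow> bool" where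
  "szego_kernel \<mu> \<alpha> n H \<longleftrightarrow>
     degree H \<le> n \<and>
     (\<forall>f. degree f \<le> n \<longrightarrow> poly f (\<alpha> n) = 0 \<longrightarrow> weighted_inner \<mu> \<alpha> n f H = 0) \<and>
     weighted_inner \<mu> \<alpha> n H H = 1 \<and>
     (\<exists>r::real. r > 0 \<and> poly H (\<alpha> n) = complex_of_real r * pole_denom \<alpha> n (\<alpha> n))"

locale disk_poles =
  fixes \<mu> :: "complex measure" and \<alpha> :: "nat \<Rightarrow> complex"
  assumes positive_measure: "positive_ae_prob_on_circle \<mu>"
    and in_disk: "\<And>j. cmod (\<alpha> j) < 1"
    and alpha_0: "\<alpha> 0 = 0"
begin

lemma prob_space_\<mu>: "prob_space \<mu>"
  and sets_\<mu>: "sets \<mu> = sets (restrict_space borel (sphere 0 1))"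
  using positive_measure by (auto simp: positive_ae_prob_on_circle_def)

lemma space_\<mu>: "space \<mu> = sphere 0 1"
  using sets_eq_imp_space_eq[OF sets_\<mu>] by (simp add: space_restrict_space)

lemma integrable_continuous_on_circle:
  fixes f :: "complex \<Rightarrow> 'b::{banach,second_countable_topology}"
  assumes "continuous_on (sphere 0 1) f"
  shows "integrable \<mu> f"
proof -
  interpret prob_space \<mu> by (rule prob_space_\<mu>)
  have "compact (f ` sphere 0 1)" using assms by (intro compact_continuous_image) auto
  then have "bounded (f ` sphere 0 1)" by (rule compact_imp_bounded)
  then obtain B where B: "\<forall>y\<in>f ` sphere 0 1. norm y \<le> B" unfolding bounded_iff by blast
  show ?thesis
  proof (rule integrable_const_bound[of _ B])
    show "AE z in \<mu>. norm (f z) \<le> B" using B space_\<mu> by (intro AE_I2) auto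
    have "f \<in> borel_measurable (restrict_space borel (sphere 0 1))"
      using assms by (rule borel_measurable_continuous_on_restrict)
    then show "f \<in> borel_measurable \<mu>" using measurable_cong_sets[OF sets_\<mu> refl] by blast
  qed
qed

lemma linear_factor_nonzero:
  assumes "cmod z \<le> 1"
  shows "1 - cnj (\<alpha> j) * z \<noteq> 0"
proof
  assume "1 - cnj (\<alpha> j) * z = 0"
  then have "cmod (cnj (\<alpha> j) * z) = 1" by simp
  moreover have "cmod (\<alpha> j) * cmod z \<le> cmod (\<alpha> j) * 1" using assms by (intro mult_left_mono) auto
  ultimately show False using in_disk[of j] by (simp add: norm_mult)
qed

lemma pole_denom_nonzero: "cmod z \<le> 1 \<Longrightarrow> pole_denom \<alpha> n z \<noteq> 0"
  using linear_factor_nonzero by (simp add: pole_denom_def)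

lemma continuous_pole_denom: "continuous_on S (pole_denom \<alpha> n)"
  unfolding pole_denom_def[abs_def] by (intro continuous_intros)

lemma integrable_weighted:
  "integrable \<mu> (\<lambda>z. cnj (poly f z) * poly g z / complex_of_real ((cmod (pole_denom \<alpha> n z))\<^sup>2))"
  by (intro integrable_continuous_on_circle continuous_intros continuous_pole_denom)
     (auto simp: pole_denom_nonzero)

lemma weighted_inner_diff_right:
  "weighted_inner \<mu> \<alpha> n f (g - h) = weighted_inner \<mu> \<alpha> n f g - weighted_inner \<mu> \<alpha> n f h"
  unfolding weighted_inner_def
  by (subst Bochner_Integration.integral_diff[symmetric, OF integrable_weighted integrable_weighted])
     (simp add: algebra_simps diff_divide_distrib)

lemma weighted_inner_diff_left:
  "weighted_inner \<mu> \<alpha> n (f - g) h = weighted_inner \<mu> \<alpha> n f h - weighted_inner \<mu> \<alpha> n g h"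
  unfolding weighted_inner_def
  by (subst Bochner_Integration.integral_diff[symmetric, OF integrable_weighted integrable_weighted])
     (simp add: algebra_simps diff_divide_distrib)

lemma weighted_inner_commute:
  "weighted_inner \<mu> \<alpha> n g f = cnj (weighted_inner \<mu> \<alpha> n f g)"
  unfolding weighted_inner_def
  by (subst Bochner_Integration.integral_cnj[symmetric], rule Bochner_Integration.integral_cong) simp_all

text \<open>
  Multiplication by \<open>z\<close> is an isometry on the circle; this is the structure behind the
  location of the zeros.
\<close>

lemma weighted_inner_shift:
  "weighted_inner \<mu> \<alpha> n (pCons 0 f) (pCons 0 g) = weighted_inner \<mu> \<alpha> n f g"
  unfolding weighted_inner_def
proof (rule Bochner_Integration.integral_cong[OF refl])
  fix z assume "z \<in> space \<mu>"
  then have zz: "cnj z * z = 1" using space_\<mu> by (simp add: complex_norm_square[symmetric] mult.commute)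
  have "cnj (poly (pCons 0 f) z) * poly (pCons 0 g) z = (cnj z * z) * (cnj (poly f z) * poly g z)"
    by (simp add: mult_ac)
  then show "cnj (poly (pCons 0 f) z) * poly (pCons 0 g) z / of_real ((cmod (pole_denom \<alpha> n z))\<^sup>2)
     = cnj (poly f z) * poly g z / of_real ((cmod (pole_denom \<alpha> n z))\<^sup>2)" using zz by simp
qed

lemma weighted_inner_smult_right:
  "weighted_inner \<mu> \<alpha> n f (smult c g) = c * weighted_inner \<mu> \<alpha> n f g"
  unfolding weighted_inner_def
  by (subst integral_mult_right_zero[symmetric]) (simp add: mult_ac)

lemma weighted_inner_smult_left:
  "weighted_inner \<mu> \<alpha> n (smult c f) g = cnj c * weighted_inner \<mu> \<alpha> n f g"
  unfolding weighted_inner_def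
  by (subst integral_mult_right_zero[symmetric]) (simp add: mult_ac)

lemma weighted_inner_self:
  "weighted_inner \<mu> \<alpha> n f f = complex_of_real (LINT z|\<mu>. (cmod (poly f z))\<^sup>2 / (cmod (pole_denom \<alpha> n z))\<^sup>2)"
proof -
  have "cnj (poly f z) * poly f z / complex_of_real ((cmod (pole_denom \<alpha> n z))\<^sup>2)
     = complex_of_real ((cmod (poly f z))\<^sup>2 / (cmod (pole_denom \<alpha> n z))\<^sup>2)" for z
    by (simp add: complex_norm_square[symmetric] mult.commute[of "cnj _"])
  then show ?thesis unfolding weighted_inner_def by (simp only: integral_complex_of_real)
qed

lemma weighted_inner_self_pos:
  assumes "f \<noteq> 0"
  shows "\<exists>m::real. m > 0 \<and> weighted_inner \<mu> \<alpha> n f f = complex_of_real m"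
proof -
  let ?g = "\<lambda>z. (cmod (poly f z))\<^sup>2 / (cmod (pole_denom \<alpha> n z))\<^sup>2"
  have int: "integrable \<mu> ?g"
    by (intro integrable_continuous_on_circle continuous_intros continuous_pole_denom)
       (auto simp: pole_denom_nonzero)
  have "integral\<^sup>L \<mu> ?g \<noteq> 0"
  proof
    assume "integral\<^sup>L \<mu> ?g = 0"
    then have "AE z in \<mu>. ?g z = 0"
      using integral_nonneg_eq_0_iff_AE[OF int] by auto
    then have "AE z in \<mu>. z \<in> {z. poly f z = 0}"
      using AE_space
    proof eventually_elim
      case (elim z)
      then show ?case using pole_denom_nonzero[of z n] space_\<mu> by auto
    qed
    then show False
      using positive_ae_not_supported_on_finite[OF positive_measure poly_roots_finite[OF assms]] by blast
  qed
  moreover have "integral\<^sup>L \<mu> ?g \<ge> 0" by (intro integral_nonneg_AE) auto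
  ultimately have "integral\<^sup>L \<mu> ?g > 0" by linarith
  then show ?thesis using weighted_inner_self by blast
qed

text \<open>
  A combination of two such polynomials that vanishes at \<open>\<alpha> n\<close> is orthogonal to both, hence to
  itself. So they are proportional; norm and phase fix the factor.
\<close>

lemma szego_kernel_unique:
  assumes H: "szego_kernel \<mu> \<alpha> n H" and K: "szego_kernel \<mu> \<alpha> n K"
  shows "H = K"
proof -
  obtain r where r: "r > 0" "poly H (\<alpha> n) = complex_of_real r * pole_denom \<alpha> n (\<alpha> n)"
    using H by (auto simp: szego_kernel_def)
  obtain s where s: "s > 0" "poly K (\<alpha> n) = complex_of_real s * pole_denom \<alpha> n (\<alpha> n)"
    using K by (auto simp: szego_kernel_def)
  \<comment> \<open>The coefficients are chosen so that the values at \<open>\<alpha> n\<close> cancel.\<close>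
  define f where "f = smult (of_real s) H - smult (of_real r) K"
  have deg: "degree f \<le> n"
    using H K unfolding f_def szego_kernel_def by (intro degree_diff_le) auto
  have "poly f (\<alpha> n) = 0" using r s by (simp add: f_def)
  then have "weighted_inner \<mu> \<alpha> n f H = 0" "weighted_inner \<mu> \<alpha> n f K = 0"
    using deg H K by (auto simp: szego_kernel_def)
  then have "weighted_inner \<mu> \<alpha> n f f = 0"
    by (subst (2) f_def) (simp add: weighted_inner_diff_right weighted_inner_smult_right)
  then have "f = 0" using weighted_inner_self_pos[of f n] by fastforce
  then have eq: "smult (of_real s) H = smult (of_real r) K" by (simp add: f_def)
  have "weighted_inner \<mu> \<alpha> n (smult (of_real s) H) (smult (of_real s) H) = of_real (s * s)"
    using H by (simp add: weighted_inner_smult_left weighted_inner_smult_right szego_kernel_def)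
  moreover have "weighted_inner \<mu> \<alpha> n (smult (of_real r) K) (smult (of_real r) K) = of_real (r * r)"
    using K by (simp add: weighted_inner_smult_left weighted_inner_smult_right szego_kernel_def)
  ultimately have "s * s = r * r" using eq of_real_eq_iff[where 'a=complex] by metis
  then have "s = r" using r s by (simp add: square_eq_iff)
  then show ?thesis using eq r by (simp add: smult_eq_iff)
qed

lemma szego_kernel_nonzero_at:
  assumes "szego_kernel \<mu> \<alpha> n H"
  shows "poly H (\<alpha> n) \<noteq> 0"
  using assms pole_denom_nonzero[of "\<alpha> n" n] in_disk[of n] by (auto simp: szego_kernel_def)

text \<open>
  Cauchy-Schwarz for \<open>q\<close> and \<open>z q\<close>, which is strict because they are linearly
  independent. Geometrically, the barycentre of the measure with density \<open>|q|\<^sup>2\<close> lies inside the disk.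
\<close>

lemma norm_moment_less:
  assumes "q \<noteq> 0" and m: "weighted_inner \<mu> \<alpha> n q q = complex_of_real m" and "m > 0"
  shows "cmod (weighted_inner \<mu> \<alpha> n q (pCons 0 q)) < m"
proof -
  define S where "S = weighted_inner \<mu> \<alpha> n q (pCons 0 q)"
  have S': "weighted_inner \<mu> \<alpha> n (pCons 0 q) q = cnj S"
    unfolding S_def by (rule weighted_inner_commute)
  define f where "f = smult (of_real m) (pCons 0 q) - smult S q"
  have "f = [:- S, of_real m:] * q" by (simp add: f_def)
  moreover have "[:- S, of_real m:] \<noteq> 0" using \<open>m > 0\<close> by simp
  ultimately have "f \<noteq> 0" using assms(1) by (metis mult_eq_0_iff)
  then obtain k :: real where k: "k > 0" "weighted_inner \<mu> \<alpha> n f f = complex_of_real k"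
    using weighted_inner_self_pos by blast
  have "complex_of_real k = of_real m * of_real m * of_real m - of_real m * (cnj S * S)"
    unfolding k(2)[symmetric] f_def
    by (simp only: weighted_inner_diff_right weighted_inner_diff_left weighted_inner_smult_left
        weighted_inner_smult_right weighted_inner_shift m S' S_def[symmetric]) (simp add: algebra_simps)
  also have "\<dots> = of_real m * of_real m * of_real m - of_real m * of_real ((cmod S)\<^sup>2)"
    by (simp only: complex_norm_square mult.commute[of "cnj S" S])
  also have "\<dots> = of_real (m * (m\<^sup>2 - (cmod S)\<^sup>2))"
    by (simp only: right_diff_distrib power2_eq_square of_real_mult of_real_diff mult.assoc)
  finally have "k = m * (m\<^sup>2 - (cmod S)\<^sup>2)" using of_real_eq_iff[where 'a=complex] by blast
  then have "0 < m * (m\<^sup>2 - (cmod S)\<^sup>2)" using k(1) by (simp only:)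
  then have "0 < m\<^sup>2 - (cmod S)\<^sup>2" using \<open>m > 0\<close> by (rule zero_less_mult_pos)
  then have "(cmod S)\<^sup>2 < m\<^sup>2" by simp
  then have "cmod S < m" using \<open>m > 0\<close> by (intro power2_less_imp_less[of "cmod S" m]) simp_all
  then show ?thesis unfolding S_def .
qed

text \<open>
  Write \<open>H = (z - w) q\<close> and test the orthogonality of \<open>H\<close> against \<open>(z - \<alpha> n) q\<close>. With \<open>m\<close> the squared
  norm of \<open>q\<close> and \<open>S\<close> its first moment this becomes one linear equation for \<open>w\<close>, whose solution
  \<open>w = (m - cnj a S) / cnj (S - a m)\<close> has modulus greater than \<open>1\<close> since \<open>|S| < m\<close> and \<open>|a| < 1\<close>.
\<close>

lemma szego_kernel_root_outside:
  assumes H: "szego_kernel \<mu> \<alpha> n H" and w: "poly H w = 0"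
  shows "cmod w > 1"
proof (cases n)
  case 0
  then obtain c where "H = [:c:]" using H by (auto simp: szego_kernel_def elim: degree_eq_zeroE)
  then show ?thesis using w szego_kernel_nonzero_at[OF H] by simp
next
  case (Suc k)
  define a where "a = \<alpha> n"
  have "degree H \<le> Suc k" using H Suc by (simp add: szego_kernel_def)
  then obtain q where q: "degree q \<le> k" "H = [:- w, 1:] * q"
    using linear_factor_obtain w by blast
  have "H \<noteq> 0" using szego_kernel_nonzero_at[OF H] by auto
  then have "q \<noteq> 0" using q by auto
  then obtain m :: real where m: "m > 0" "weighted_inner \<mu> \<alpha> n q q = complex_of_real m"
    using weighted_inner_self_pos by blast
  define S where "S = weighted_inner \<mu> \<alpha> n q (pCons 0 q)"
  have S': "weighted_inner \<mu> \<alpha> n (pCons 0 q) q = cnj S"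
    unfolding S_def by (rule weighted_inner_commute)
  have S: "cmod S < m" unfolding S_def by (rule norm_moment_less[OF \<open>q \<noteq> 0\<close> m(2,1)])
  have H': "H = pCons 0 q - smult w q" using q by simp
  define f where "f = pCons 0 q - smult a q"
  have f: "f = [:- a, 1:] * q" by (simp add: f_def)
  have "degree f \<le> n" using degree_mult_le[of "[:- a, 1:]" q] q Suc by (simp add: f)
  moreover have "poly f (\<alpha> n) = 0" by (simp add: f_def a_def)
  ultimately have "weighted_inner \<mu> \<alpha> n f H = 0" using H by (simp add: szego_kernel_def)
  moreover have "weighted_inner \<mu> \<alpha> n f H = of_real m - w * cnj S - cnj a * (S - w * of_real m)"
    unfolding H' f_def
    by (simp only: weighted_inner_diff_right weighted_inner_diff_left weighted_inner_smult_left
        weighted_inner_smult_right weighted_inner_shift m S' S_def[symmetric])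
      (simp add: algebra_simps)
  ultimately have eq: "w * cnj (S - a * of_real m) = of_real m - cnj a * S"
    by (simp add: algebra_simps)
  have "(cmod (of_real m - cnj a * S))\<^sup>2 - (cmod (S - a * of_real m))\<^sup>2
      = (m\<^sup>2 - (cmod S)\<^sup>2) * (1 - (cmod a)\<^sup>2)"
    unfolding cmod_power2 by (simp add: power2_eq_square algebra_simps)
  moreover have "\<dots> > 0"
    using S in_disk[of n] m(1) by (intro mult_pos_pos)
      (auto simp: a_def abs_square_less_1 intro!: power_strict_mono)
  ultimately have "(cmod (S - a * of_real m))\<^sup>2 < (cmod (of_real m - cnj a * S))\<^sup>2" by linarith
  then have lt: "cmod (S - a * of_real m) < cmod (of_real m - cnj a * S)"
    by (rule power2_less_imp_less) simp
  have "cmod w * cmod (S - a * of_real m) = cmod (of_real m - cnj a * S)"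
    unfolding eq[symmetric] by (simp only: norm_mult complex_mod_cnj)
  with lt have "1 * cmod (S - a * of_real m) < cmod w * cmod (S - a * of_real m)" by simp
  then show ?thesis by (rule mult_right_less_imp_less) simp
qed

lemma szego_kernel_nonzero_in_disk:
  assumes "szego_kernel \<mu> \<alpha> n H" "cmod a < 1"
  shows "poly H a \<noteq> 0"
  using szego_kernel_root_outside[OF assms(1), of a] assms(2) by auto

lemma szego_kernel_dominates:
  assumes H: "szego_kernel \<mu> \<alpha> n H" and "n \<ge> 1" "cmod a < 1"
  shows "cmod (poly (poly_star n H) a) < cmod (poly H a)"
proof -
  have "H \<noteq> 0" using szego_kernel_nonzero_at[OF H] by auto
  then show ?thesis
    using norm_reversed_le[of H n a] szego_kernel_root_outside[OF H] assms
    by (auto simp: szego_kernel_def)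
qed

end

section \<open>Rational functions with prescribed poles as polynomials\<close>

text \<open>
  The real number that makes the factor for \<open>\<beta> j\<close> equal to \<open>sigma / pole_scale\<close> times \<open>z - \<alpha> j\<close>.
  The value \<open>-1\<close> comes from the convention that the factor is \<open>-z\<close> when the pole is at infinity.
\<close>

definition pole_scale :: "(nat \<Rightarrow> complex) \<Rightarrow> nat \<Rightarrow> real" where
  "pole_scale \<alpha> j = (if \<alpha> j = 0 then -1 else - cmod (\<alpha> j))"

definition beta_scale :: "(nat \<Rightarrow> complex) \<Rightarrow> (nat \<Rightarrow> ecomplex) \<Rightarrow> nat \<Rightarrow> real" where
  "beta_scale \<alpha> \<gamma> n = (\<Prod>j=1..n. if \<gamma> j = beta_poles \<alpha> j then 1 / pole_scale \<alpha> j else 1)"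

text \<open>
  Rational functions are total functions with \<open>x / 0 = 0\<close>, so the identities between them hold only
  away from zeros and poles. The values on the circle do not suffice, since the
  normalizations are limits at \<open>\<alpha> n\<close> and \<open>\<beta> n\<close>; the points below form a cofinite set that contains the
  circle and is stable under reflection in it.
\<close>

definition regular_point :: "(nat \<Rightarrow> complex) \<Rightarrow> nat \<Rightarrow> complex \<Rightarrow> bool" where
  "regular_point \<alpha> n z \<longleftrightarrow> z \<noteq> 0 \<and> (\<forall>j\<in>{1..n}. z \<noteq> \<alpha> j \<and> 1 - cnj (\<alpha> j) * z \<noteq> 0)"

fun varpi_poly :: "ecomplex \<Rightarrow> complex poly" where
  "varpi_poly (Fin v) = [:1, - cnj v:]"
| "varpi_poly Infty = [:0, -1:]"

definition varpi_prod :: "(nat \<Rightarrow> ecomplex) \<Rightarrow> nat \<Rightarrow> complex \<Rightarrow> complex" where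
  "varpi_prod \<nu> n z = (\<Prod>j=1..n. varpi (\<nu> j) z)"

definition node_poly :: "(nat \<Rightarrow> complex) \<Rightarrow> nat \<Rightarrow> complex poly" where
  "node_poly \<alpha> n = (\<Prod>j=1..n. [:- \<alpha> j, 1:])"

definition denom_poly :: "(nat \<Rightarrow> complex) \<Rightarrow> nat \<Rightarrow> complex poly" where
  "denom_poly \<alpha> n = (\<Prod>j=1..n. [:1, - cnj (\<alpha> j):])"

lemma poly_node_poly: "poly (node_poly \<alpha> n) z = (\<Prod>j=1..n. z - \<alpha> j)"
  by (simp add: node_poly_def poly_prod)

lemma poly_denom_poly: "poly (denom_poly \<alpha> n) z = pole_denom \<alpha> n z"
  by (simp add: denom_poly_def pole_denom_def poly_prod mult.commute)

lemma degree_prod_linear: "degree (\<Prod>j=1..n. [:a j, b j:] :: complex poly) \<le> n"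
proof -
  have "degree (\<Prod>j=1..n. [:a j, b j:]) \<le> (\<Sum>j=1..n. degree [:a j, b j:])"
    using degree_prod_sum_le[of "{1..n}" "\<lambda>j. [:a j, b j:]"] by (simp add: comp_def)
  also have "\<dots> \<le> (\<Sum>j=1..n. 1)" by (intro sum_mono) auto
  finally show ?thesis by simp
qed

lemma degree_node_poly: "degree (node_poly \<alpha> n) \<le> n"
  and degree_denom_poly: "degree (denom_poly \<alpha> n) \<le> n"
  unfolding node_poly_def denom_poly_def by (rule degree_prod_linear)+

lemma poly_star_node_poly: "poly_star n (node_poly \<alpha> n) = denom_poly \<alpha> n"
proof (induction n)
  case 0
  show ?case by (simp add: node_poly_def denom_poly_def poly_star_def monom_0)
next
  case (Suc n)
  have "node_poly \<alpha> (Suc n) = [:- \<alpha> (Suc n), 1:] * node_poly \<alpha> n"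
    "denom_poly \<alpha> (Suc n) = [:1, - cnj (\<alpha> (Suc n)):] * denom_poly \<alpha> n"
    by (simp_all add: node_poly_def denom_poly_def mult.commute del: mult_pCons_left mult_pCons_right)
  then show ?case using poly_star_root_mult[OF degree_node_poly] Suc.IH by metis
qed

lemma poly_varpi_poly: "poly (varpi_poly v) z = varpi v z"
  by (cases v) simp_all

lemma degree_varpi_poly: "degree (varpi_poly v) \<le> 1"
  by (cases v) simp_all

lemma pole_scale_nonzero: "pole_scale \<alpha> j \<noteq> 0"
  by (simp add: pole_scale_def)

lemma beta_scale_nonzero: "beta_scale \<alpha> \<gamma> n \<noteq> 0"
  by (simp add: beta_scale_def pole_scale_nonzero)

lemma norm_sigma: "cmod (sigma \<alpha> j) = 1"
  by (simp add: sigma_def norm_divide)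

lemma sigma_nonzero: "sigma \<alpha> j \<noteq> 0"
  using norm_sigma[of \<alpha> j] by auto

lemma norm_varsigma: "cmod (varsigma \<alpha> n) = 1"
  by (simp add: varsigma_def norm_sigma prod_norm[symmetric])

lemma varsigma_cnj: "varsigma \<alpha> n * cnj (varsigma \<alpha> n) = 1"
  using norm_varsigma[of \<alpha> n] by (simp add: complex_norm_square[symmetric])

lemma varsigma_nonzero: "varsigma \<alpha> n \<noteq> 0"
  using norm_varsigma[of \<alpha> n] by auto

lemma cnj_varsigma: "cnj (varsigma \<alpha> n) = 1 / varsigma \<alpha> n"
  using varsigma_cnj[of \<alpha> n] varsigma_nonzero[of \<alpha> n] by (simp add: eq_divide_eq mult.commute)

lemma varpi_beta: "varpi (beta_poles \<alpha> j) z = sigma \<alpha> j / complex_of_real (pole_scale \<alpha> j) * (z - \<alpha> j)"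
proof (cases "\<alpha> j = 0")
  case False
  have "cnj (\<alpha> j) / (of_real (cmod (\<alpha> j)) * - of_real (cmod (\<alpha> j))) = - inverse (\<alpha> j)"
    using False complex_norm_square[of "\<alpha> j"] by (simp add: power2_eq_square field_simps)
  then show ?thesis using False
    by (simp add: beta_poles_def sigma_def pole_scale_def) (simp add: field_simps)
qed (simp add: beta_poles_def sigma_def pole_scale_def)

lemma zeta_beta: "zeta \<alpha> (beta_poles \<alpha>) j z = (1 - cnj (\<alpha> j) * z) / (sigma \<alpha> j * (z - \<alpha> j))"
proof (cases "\<alpha> j = 0")
  case False
  show ?thesis
  proof (cases "z = \<alpha> j")
    case True
    then show ?thesis using False by (simp add: zeta_def beta_poles_def)
  next
    case z: False
    have b: "varpi_star (beta_poles \<alpha> j) z = - (1 - cnj (\<alpha> j) * z) / cnj (\<alpha> j)"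
      using False by (simp add: beta_poles_def field_simps)
    have "zeta \<alpha> (beta_poles \<alpha>) j z
      = of_real (pole_scale \<alpha> j) * (- (1 - cnj (\<alpha> j) * z) / cnj (\<alpha> j)) / (z - \<alpha> j)"
      unfolding zeta_def varpi_beta b using z False sigma_nonzero[of \<alpha> j]
      by (simp add: field_simps)
    also have "\<dots> = (1 - cnj (\<alpha> j) * z) / (sigma \<alpha> j * (z - \<alpha> j))"
      using False z by (simp add: pole_scale_def sigma_def divide_simps) (simp add: algebra_simps)
    finally show ?thesis .
  qed
qed (simp add: zeta_def beta_poles_def sigma_def)

lemma zeta_alpha: "zeta \<alpha> (alpha_poles \<alpha>) j z = sigma \<alpha> j * (z - \<alpha> j) / (1 - cnj (\<alpha> j) * z)"
  by (simp add: zeta_def alpha_poles_def)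

lemma blaschke_dot_if:
  "blaschke_dot \<alpha> \<gamma> \<nu> n z = (\<Prod>j=1..n. if \<gamma> j = \<nu> j then zeta \<alpha> \<nu> j z else 1)"
proof -
  have "{j. 1 \<le> j \<and> j \<le> n \<and> \<gamma> j = \<nu> j} = {j \<in> {1..n}. \<gamma> j = \<nu> j}" by auto
  then show ?thesis unfolding blaschke_dot_def by (simp only: prod.inter_filter finite_atLeastAtMost)
qed

lemma lspace_0: "lspace B 0 = {f. \<exists>c. f = (\<lambda>z. c * B 0 z)}"
  by (auto simp: lspace_def)

lemma lspace_SucE:
  assumes "f \<in> lspace B (Suc n)"
  obtains g c where "g \<in> lspace B n" "f = (\<lambda>z. g z + c * B (Suc n) z)"
proof -
  obtain c where "f = (\<lambda>z. \<Sum>k\<le>Suc n. c k * B k z)" using assms by (auto simp: lspace_def)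
  then have "f = (\<lambda>z. (\<Sum>k\<le>n. c k * B k z) + c (Suc n) * B (Suc n) z)" by simp
  moreover have "(\<lambda>z. \<Sum>k\<le>n. c k * B k z) \<in> lspace B n" by (auto simp: lspace_def)
  ultimately show thesis using that by blast
qed

lemma lspace_SucI:
  assumes "g \<in> lspace B n"
  shows "(\<lambda>z. g z + c * B (Suc n) z) \<in> lspace B (Suc n)"
proof -
  obtain d where d: "g = (\<lambda>z. \<Sum>k\<le>n. d k * B k z)" using assms by (auto simp: lspace_def)
  have "(\<lambda>z. g z + c * B (Suc n) z) = (\<lambda>z. \<Sum>k\<le>Suc n. (d(Suc n := c)) k * B k z)"
  proof
    fix z
    have "(\<Sum>k\<le>n. (d(Suc n := c)) k * B k z) = (\<Sum>k\<le>n. d k * B k z)" by (intro sum.cong) auto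
    then show "g z + c * B (Suc n) z = (\<Sum>k\<le>Suc n. (d(Suc n := c)) k * B k z)" by (simp add: d)
  qed
  then show ?thesis unfolding lspace_def by blast
qed

context disk_poles
begin

lemma alpha_poles_neq_beta_poles: "alpha_poles \<alpha> j \<noteq> beta_poles \<alpha> j"
proof
  assume eq: "alpha_poles \<alpha> j = beta_poles \<alpha> j"
  then have "\<alpha> j \<noteq> 0" by (auto simp: alpha_poles_def beta_poles_def)
  with eq have "\<alpha> j = inverse (cnj (\<alpha> j))" by (simp add: alpha_poles_def beta_poles_def)
  then have "\<alpha> j * cnj (\<alpha> j) = 1" using \<open>\<alpha> j \<noteq> 0\<close> by (metis right_inverse complex_cnj_zero_iff mult.commute)
  then have "(cmod (\<alpha> j))\<^sup>2 = 1" by (metis complex_mod_mult_cnj norm_one)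
  then show False using in_disk[of j] norm_ge_zero[of "\<alpha> j"] by (auto simp: power2_eq_1_iff simp del: norm_ge_zero)
qed

lemma regular_point_circle: "cmod z = 1 \<Longrightarrow> regular_point \<alpha> n z"
  unfolding regular_point_def using in_disk linear_factor_nonzero[of z] by (metis less_irrefl norm_zero order_refl zero_neq_one)

lemma regular_point_reflect:
  assumes "regular_point \<alpha> n z"
  shows "regular_point \<alpha> n (1 / cnj z)"
proof -
  have "1 / cnj z \<noteq> \<alpha> j \<and> 1 - cnj (\<alpha> j) * (1 / cnj z) \<noteq> 0"
    if "z \<noteq> 0" "z \<noteq> \<alpha> j" "1 - cnj (\<alpha> j) * z \<noteq> 0" for j
  proof
    show "1 / cnj z \<noteq> \<alpha> j"
    proof
      assume "1 / cnj z = \<alpha> j"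
      then have "cnj (\<alpha> j) = 1 / z" by (metis complex_cnj_cnj complex_cnj_divide complex_cnj_one)
      then have "cnj (\<alpha> j) * z = 1" using that(1) by simp
      then show False using that by simp
    qed
    show "1 - cnj (\<alpha> j) * (1 / cnj z) \<noteq> 0"
    proof
      assume "1 - cnj (\<alpha> j) * (1 / cnj z) = 0"
      then have "cnj (\<alpha> j) = cnj z" using that(1) by (simp add: field_simps)
      then show False using that by simp
    qed
  qed
  then show ?thesis using assms by (auto simp: regular_point_def)
qed

lemma finite_not_regular: "finite {z. \<not> regular_point \<alpha> n z}"
proof -
  have "finite {z. 1 - cnj (\<alpha> j) * z = 0}" for j
    using poly_roots_finite[of "[:1, - cnj (\<alpha> j):]"] by (simp add: mult.commute)
  then have "finite (insert 0 (\<alpha> ` {1..n}) \<union> (\<Union>j\<in>{1..n}. {z. 1 - cnj (\<alpha> j) * z = 0}))" by auto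
  moreover have "{z. \<not> regular_point \<alpha> n z} \<subseteq> insert 0 (\<alpha> ` {1..n}) \<union> (\<Union>j\<in>{1..n}. {z. 1 - cnj (\<alpha> j) * z = 0})"
    by (auto simp: regular_point_def)
  ultimately show ?thesis using finite_subset by blast
qed

end

locale mixed_poles = disk_poles +
  fixes \<gamma> :: "nat \<Rightarrow> ecomplex"
  assumes gamma_cases: "\<And>j. \<gamma> j = alpha_poles \<alpha> j \<or> \<gamma> j = beta_poles \<alpha> j"
begin

lemma gamma_iff: "\<gamma> j = beta_poles \<alpha> j \<longleftrightarrow> \<gamma> j \<noteq> alpha_poles \<alpha> j"
  using gamma_cases[of j] alpha_poles_neq_beta_poles[of j] by auto

lemma varpi_nonzero: "regular_point \<alpha> n z \<Longrightarrow> j \<in> {1..n} \<Longrightarrow> varpi (\<gamma> j) z \<noteq> 0"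
  using gamma_cases[of j] pole_scale_nonzero[of \<alpha> j] sigma_nonzero[of \<alpha> j]
  by (auto simp: regular_point_def varpi_beta) (auto simp: alpha_poles_def)

lemma varpi_prod_nonzero: "regular_point \<alpha> n z \<Longrightarrow> varpi_prod \<gamma> n z \<noteq> 0"
  using varpi_nonzero by (auto simp: varpi_prod_def)

text \<open>
  Multiplied by the common denominator, either dotted Blaschke product becomes a polynomial that
  depends on the choice of \<open>\<gamma>\<close> only through a constant: every index contributes a factor
  \<open>z - \<alpha> j\<close> here, and a factor \<open>1 - cnj (\<alpha> j) z\<close> in the companion lemma.
\<close>

lemma blaschke_dot_alpha:
  assumes "regular_point \<alpha> n z"
  shows "blaschke_dot \<alpha> \<gamma> (alpha_poles \<alpha>) n z * varpi_prod \<gamma> n z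
    = varsigma \<alpha> n * of_real (beta_scale \<alpha> \<gamma> n) * (\<Prod>j=1..n. z - \<alpha> j)"
  unfolding varpi_prod_def blaschke_dot_if varsigma_def beta_scale_def of_real_prod prod.distrib[symmetric]
proof (rule prod.cong[OF refl])
  fix j assume j: "j \<in> {1..n}"
  show "(if \<gamma> j = alpha_poles \<alpha> j then zeta \<alpha> (alpha_poles \<alpha>) j z else 1) * varpi (\<gamma> j) z
    = sigma \<alpha> j * of_real (if \<gamma> j = beta_poles \<alpha> j then 1 / pole_scale \<alpha> j else 1) * (z - \<alpha> j)"
  proof (cases "\<gamma> j = alpha_poles \<alpha> j")
    case True
    have "1 - cnj (\<alpha> j) * z \<noteq> 0" using assms j by (auto simp: regular_point_def)
    then show ?thesis using True gamma_iff[of j] by (simp add: zeta_alpha) (simp add: alpha_poles_def)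
  next
    case False
    then have "\<gamma> j = beta_poles \<alpha> j" using gamma_iff by blast
    then show ?thesis using False by (simp add: varpi_beta)
  qed
qed

lemma blaschke_dot_beta:
  assumes "regular_point \<alpha> n z"
  shows "blaschke_dot \<alpha> \<gamma> (beta_poles \<alpha>) n z * varpi_prod \<gamma> n z
    = of_real (beta_scale \<alpha> \<gamma> n) * pole_denom \<alpha> n z"
  unfolding varpi_prod_def blaschke_dot_if pole_denom_def beta_scale_def of_real_prod prod.distrib[symmetric]
proof (rule prod.cong[OF refl])
  fix j assume j: "j \<in> {1..n}"
  show "(if \<gamma> j = beta_poles \<alpha> j then zeta \<alpha> (beta_poles \<alpha>) j z else 1) * varpi (\<gamma> j) z
    = of_real (if \<gamma> j = beta_poles \<alpha> j then 1 / pole_scale \<alpha> j else 1) * (1 - cnj (\<alpha> j) * z)"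
  proof (cases "\<gamma> j = alpha_poles \<alpha> j")
    case True
    then show ?thesis using gamma_iff[of j] by (simp add: alpha_poles_def)
  next
    case False
    then have b: "\<gamma> j = beta_poles \<alpha> j" using gamma_iff by blast
    have "z - \<alpha> j \<noteq> 0" using assms j by (auto simp: regular_point_def)
    then show ?thesis using b sigma_nonzero[of \<alpha> j] by (simp add: zeta_beta varpi_beta)
  qed
qed

definition gamma_numer :: "nat \<Rightarrow> complex poly" where
  "gamma_numer n = (if \<gamma> n = alpha_poles \<alpha> n
     then smult (varsigma \<alpha> n * of_real (beta_scale \<alpha> \<gamma> n)) (node_poly \<alpha> n)
     else smult (of_real (beta_scale \<alpha> \<gamma> n)) (denom_poly \<alpha> n))"

lemma degree_gamma_numer: "degree (gamma_numer n) \<le> n"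
  unfolding gamma_numer_def using degree_node_poly degree_denom_poly by (auto intro: order_trans[OF degree_smult_le])

lemma poly_gamma_numer:
  assumes "regular_point \<alpha> n z"
  shows "poly (gamma_numer n) z = blaschke_gamma \<alpha> \<gamma> n z * varpi_prod \<gamma> n z"
  using blaschke_dot_alpha[OF assms] blaschke_dot_beta[OF assms]
  by (simp add: gamma_numer_def blaschke_gamma_def poly_node_poly poly_denom_poly)

text \<open>
  The numerator of the newest basis function does not vanish at the zero of the newest denominator
  factor, so a multiple of it can be subtracted to make any polynomial divisible by that factor.
  This is what lets the basis functions span all numerators.
\<close>

lemma gamma_numer_transversal:
  assumes p: "degree p \<le> Suc n"
  obtains c q where "degree q \<le> n" "p = smult c (gamma_numer (Suc n)) + varpi_poly (\<gamma> (Suc n)) * q"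
proof -
  define a where "a = \<alpha> (Suc n)"
  have nz: "pole_denom \<alpha> (Suc n) a \<noteq> 0" using in_disk by (simp add: a_def pole_denom_nonzero less_imp_le)
  show thesis
  proof (cases "\<gamma> (Suc n) = alpha_poles \<alpha> (Suc n)")
    case True
    let ?N = "gamma_numer (Suc n)"
    \<comment> \<open>The zero of the factor is the reflection of \<open>a\<close>, possibly infinite, so values are read off from reversals.\<close>
    have star: "poly (poly_star (Suc n) ?N) a \<noteq> 0"
      using True nz norm_varsigma[of \<alpha> "Suc n"] beta_scale_nonzero[of \<alpha> \<gamma> "Suc n"]
      by (auto simp: gamma_numer_def poly_star_smult poly_star_node_poly poly_denom_poly)
    define c where "c = cnj (poly (poly_star (Suc n) p) a / poly (poly_star (Suc n) ?N) a)"
    have "poly_star (Suc n) (p - smult c ?N) = poly_star (Suc n) p - smult (cnj c) (poly_star (Suc n) ?N)"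
      by (rule poly_eqI) (simp add: coeff_poly_star)
    then have "poly (poly_star (Suc n) (p - smult c ?N)) a = 0" using star by (simp add: c_def)
    moreover have "degree (p - smult c ?N) \<le> Suc n"
      using p degree_gamma_numer[of "Suc n"] by (intro degree_diff_le) (auto intro: order_trans[OF degree_smult_le])
    ultimately obtain q where "degree q \<le> n" "p - smult c ?N = [:1, - cnj a:] * q"
      using reversed_factor_obtain by blast
    then show thesis using that[of q c] True by (simp add: alpha_poles_def a_def algebra_simps)
  next
    case False
    then have b: "\<gamma> (Suc n) = beta_poles \<alpha> (Suc n)" using gamma_iff by blast
    let ?N = "gamma_numer (Suc n)"
    have "poly ?N a \<noteq> 0"
      using False nz beta_scale_nonzero by (simp add: gamma_numer_def poly_denom_poly)
    then have "poly (p - smult (poly p a / poly ?N a) ?N) a = 0" by simp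
    moreover have "degree (p - smult (poly p a / poly ?N a) ?N) \<le> Suc n"
      using p degree_gamma_numer[of "Suc n"] by (intro degree_diff_le) (auto intro: order_trans[OF degree_smult_le])
    ultimately obtain q where q: "degree q \<le> n" "p - smult (poly p a / poly ?N a) ?N = [:- a, 1:] * q"
      using linear_factor_obtain by blast
    let ?k = "sigma \<alpha> (Suc n) / of_real (pole_scale \<alpha> (Suc n))"
    have k: "?k \<noteq> 0" using sigma_nonzero pole_scale_nonzero by simp
    have "varpi_poly (\<gamma> (Suc n)) = smult ?k [:- a, 1:]"
      by (rule poly_eqI_unit_circle) (simp add: poly_varpi_poly b varpi_beta a_def algebra_simps diff_divide_distrib)
    moreover have "smult ?k L * smult (1 / ?k) q = L * q" for L
      using k by simp
    ultimately have "varpi_poly (\<gamma> (Suc n)) * smult (1 / ?k) q = [:- a, 1:] * q"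
      by (simp only:)
    then have "p = smult (poly p a / poly ?N a) ?N + varpi_poly (\<gamma> (Suc n)) * smult (1 / ?k) q"
      using q(2) by (simp only: diff_eq_eq add.commute)
    moreover have "degree (smult (1 / ?k) q) \<le> n" using q(1) degree_smult_le order_trans by blast
    ultimately show thesis using that by blast
  qed
qed

lemma varpi_prod_Suc: "varpi_prod \<gamma> (Suc n) z = varpi_prod \<gamma> n z * varpi (\<gamma> (Suc n)) z"
  by (simp add: varpi_prod_def)

lemma regular_point_Suc: "regular_point \<alpha> (Suc n) z \<Longrightarrow> regular_point \<alpha> n z"
  by (auto simp: regular_point_def)

lemma lspace_numerator:
  assumes "f \<in> lspace (blaschke_gamma \<alpha> \<gamma>) n"
  shows "\<exists>p. degree p \<le> n \<and> (\<forall>z. regular_point \<alpha> n z \<longrightarrow> poly p z = f z * varpi_prod \<gamma> n z)"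
  using assms
proof (induction n arbitrary: f)
  case 0
  then obtain c where "f = (\<lambda>z. c * blaschke_gamma \<alpha> \<gamma> 0 z)" by (auto simp: lspace_0)
  then show ?case by (intro exI[of _ "smult c (gamma_numer 0)"])
    (use poly_gamma_numer[of 0] degree_gamma_numer[of 0] in auto)
next
  case (Suc n)
  obtain g c where g: "g \<in> lspace (blaschke_gamma \<alpha> \<gamma>) n"
    "f = (\<lambda>z. g z + c * blaschke_gamma \<alpha> \<gamma> (Suc n) z)"
    using lspace_SucE[OF Suc.prems] by blast
  obtain p where p: "degree p \<le> n" "\<And>z. regular_point \<alpha> n z \<Longrightarrow> poly p z = g z * varpi_prod \<gamma> n z"
    using Suc.IH[OF g(1)] by blast
  let ?p = "varpi_poly (\<gamma> (Suc n)) * p + smult c (gamma_numer (Suc n))"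
  have "degree ?p \<le> Suc n"
    using degree_gamma_numer[of "Suc n"] degree_mult_le[of "varpi_poly (\<gamma> (Suc n))" p]
      degree_varpi_poly[of "\<gamma> (Suc n)"] p(1)
    by (intro degree_add_le order_trans[OF degree_smult_le]) auto
  moreover have "poly ?p z = f z * varpi_prod \<gamma> (Suc n) z" if "regular_point \<alpha> (Suc n) z" for z
    using poly_gamma_numer[OF that] p(2)[OF regular_point_Suc[OF that]]
    unfolding g(2) poly_add poly_mult poly_smult poly_varpi_poly varpi_prod_Suc
    by (simp add: algebra_simps)
  ultimately show ?case by blast
qed

lemma numerator_lspace:
  assumes "degree p \<le> n"
  shows "\<exists>f\<in>lspace (blaschke_gamma \<alpha> \<gamma>) n. \<forall>z. regular_point \<alpha> n z \<longrightarrow> poly p z = f z * varpi_prod \<gamma> n z"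
  using assms
proof (induction n arbitrary: p)
  case 0
  then obtain c where c: "p = [:c:]" by (auto elim: degree_eq_zeroE)
  have "blaschke_gamma \<alpha> \<gamma> 0 z = 1" for z by (simp add: blaschke_gamma_def blaschke_dot_if)
  then show ?case unfolding lspace_0 c by (intro bexI[of _ "\<lambda>z. c * blaschke_gamma \<alpha> \<gamma> 0 z"]) (auto simp: varpi_prod_def)
next
  case (Suc n)
  obtain c q where q: "degree q \<le> n" "p = smult c (gamma_numer (Suc n)) + varpi_poly (\<gamma> (Suc n)) * q"
    using gamma_numer_transversal[OF Suc.prems] by blast
  obtain g where g: "g \<in> lspace (blaschke_gamma \<alpha> \<gamma>) n"
    "\<And>z. regular_point \<alpha> n z \<Longrightarrow> poly q z = g z * varpi_prod \<gamma> n z"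
    using Suc.IH[OF q(1)] by blast
  have "poly p z = (g z + c * blaschke_gamma \<alpha> \<gamma> (Suc n) z) * varpi_prod \<gamma> (Suc n) z"
    if "regular_point \<alpha> (Suc n) z" for z
    using poly_gamma_numer[OF that] g(2)[OF regular_point_Suc[OF that]]
    unfolding q(2) poly_add poly_mult poly_smult poly_varpi_poly varpi_prod_Suc
    by (simp add: algebra_simps)
  then show ?case by (intro bexI[OF _ lspace_SucI[OF g(1), of c]]) simp
qed

end

section \<open>The orthonormal functions and the reproducing kernel\<close>

lemma eventually_punctured_nhds_finite:
  assumes "finite S"
  shows "eventually (\<lambda>z. z \<notin> S) (punctured_nhds w)"
proof (cases w)
  case (Fin a)
  then show ?thesis using islimpt_finite[OF assms, of a] by (simp add: islimpt_iff_eventually)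
next
  case Infty
  obtain B where B: "\<And>z. z \<in> S \<Longrightarrow> cmod z \<le> B" using finite_imp_bounded[OF assms] by (auto simp: bounded_iff)
  have "eventually (\<lambda>z. z \<notin> S) at_infinity"
    unfolding eventually_at_infinity using B by (intro exI[of _ "B + 1"]) force
  then show ?thesis using Infty by simp
qed

lemma punctured_nhds_neq_bot: "punctured_nhds w \<noteq> bot"
  using trivial_limit_at_infinity by (cases w) simp_all

lemma norm_reflected_factor:
  assumes "cmod z = 1"
  shows "cmod (1 - cnj a * z) = cmod (z - a)"
proof -
  have "z * cnj z = 1" using assms by (simp add: complex_norm_square[symmetric])
  then have "z * cnj (z - a) = 1 - cnj a * z" by (simp add: algebra_simps)
  then have "cmod (1 - cnj a * z) = cmod z * cmod (cnj (z - a))" by (metis norm_mult)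
  then show ?thesis using assms by (simp only: complex_mod_cnj mult_1)
qed

lemma (in disk_poles) reflection_tendsto:
  "((\<lambda>z. 1 / cnj z) \<longlongrightarrow> \<alpha> n) (punctured_nhds (beta_poles \<alpha> n))"
proof (cases "\<alpha> n = 0")
  case True
  have "((\<lambda>z::complex. cnj (inverse z)) \<longlongrightarrow> cnj 0) at_infinity"
    by (intro tendsto_cnj tendsto_inverse_0)
  then show ?thesis using True by (simp add: beta_poles_def inverse_eq_divide)
next
  case False
  have "((\<lambda>z. 1 / cnj z) \<longlongrightarrow> 1 / cnj (inverse (cnj (\<alpha> n)))) (at (inverse (cnj (\<alpha> n))))"
    using False by (intro tendsto_intros) auto
  then show ?thesis using False by (simp add: beta_poles_def inverse_eq_divide)
qed

locale mixed_orf = mixed_poles +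
  fixes \<phi> :: "nat \<Rightarrow> complex \<Rightarrow> complex"
  assumes orf: "orf_gamma \<mu> \<alpha> \<gamma> \<phi>"
begin

lemma phi_0: "\<phi> 0 = (\<lambda>z. 1)"
  using orf by (simp add: orf_gamma_def orthonormal_functions_def)

lemma phi_in_lspace: "\<phi> n \<in> lspace (blaschke_gamma \<alpha> \<gamma>) n"
proof (cases "n = 0")
  case True
  have "blaschke_gamma \<alpha> \<gamma> 0 z = 1" for z by (simp add: blaschke_gamma_def blaschke_dot_if)
  then show ?thesis unfolding True lspace_0 phi_0 by (intro CollectI exI[of _ 1]) simp
next
  case False
  then show ?thesis using orf by (auto simp: orf_gamma_def orthonormal_functions_def)
qed

lemma numer_poly_props:
  "degree (numer_poly \<gamma> \<phi> n) \<le> n"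
  "regular_point \<alpha> n z \<Longrightarrow> poly (numer_poly \<gamma> \<phi> n) z = \<phi> n z * varpi_prod \<gamma> n z"
proof -
  obtain p where p: "degree p \<le> n" "\<And>z. regular_point \<alpha> n z \<Longrightarrow> poly p z = \<phi> n z * varpi_prod \<gamma> n z"
    using lspace_numerator[OF phi_in_lspace] by blast
  have "numer_poly \<gamma> \<phi> n = p"
    unfolding numer_poly_def varpi_prod_def[symmetric]
  proof (rule the_equality)
    show "\<forall>z\<in>sphere 0 1. poly p z = \<phi> n z * varpi_prod \<gamma> n z"
      using p(2) regular_point_circle by simp
    fix q assume "\<forall>z\<in>sphere 0 1. poly q z = \<phi> n z * varpi_prod \<gamma> n z"
    then show "q = p" using p(2) regular_point_circle by (intro poly_eqI_unit_circle) simp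
  qed
  with p show "degree (numer_poly \<gamma> \<phi> n) \<le> n"
    "regular_point \<alpha> n z \<Longrightarrow> poly (numer_poly \<gamma> \<phi> n) z = \<phi> n z * varpi_prod \<gamma> n z" by simp_all
qed

lemma norm_varpi_prod:
  assumes "cmod z = 1"
  shows "cmod (varpi_prod \<gamma> n z) = \<bar>beta_scale \<alpha> \<gamma> n\<bar> * cmod (pole_denom \<alpha> n z)"
  unfolding varpi_prod_def beta_scale_def pole_denom_def prod_norm[symmetric] abs_prod prod.distrib[symmetric]
proof (rule prod.cong[OF refl])
  fix j
  show "cmod (varpi (\<gamma> j) z) = \<bar>if \<gamma> j = beta_poles \<alpha> j then 1 / pole_scale \<alpha> j else 1\<bar> * cmod (1 - cnj (\<alpha> j) * z)"
  proof (cases "\<gamma> j = alpha_poles \<alpha> j")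
    case True
    then show ?thesis using gamma_iff[of j] by (simp add: alpha_poles_def)
  next
    case False
    then have "\<gamma> j = beta_poles \<alpha> j" using gamma_iff by blast
    then show ?thesis using norm_reflected_factor[OF assms, of "\<alpha> j"]
      by (simp add: varpi_beta norm_mult norm_divide norm_sigma)
  qed
qed

lemma weight_varpi_prod:
  assumes "cmod z = 1"
  shows "cnj (varpi_prod \<gamma> n z) * varpi_prod \<gamma> n z
    = of_real ((beta_scale \<alpha> \<gamma> n)\<^sup>2) * of_real ((cmod (pole_denom \<alpha> n z))\<^sup>2)"
proof -
  have "cnj (varpi_prod \<gamma> n z) * varpi_prod \<gamma> n z = of_real ((cmod (varpi_prod \<gamma> n z))\<^sup>2)"
    by (simp only: complex_norm_square mult.commute)
  also have "\<dots> = of_real ((beta_scale \<alpha> \<gamma> n)\<^sup>2 * (cmod (pole_denom \<alpha> n z))\<^sup>2)"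
    by (simp only: norm_varpi_prod[OF assms] power_mult_distrib power2_abs)
  finally show ?thesis by (simp only: of_real_mult)
qed

text \<open>
  The numerator of \<open>\<phi> n\<close>, reversed if \<open>\<gamma> n = \<alpha> n\<close>, with the constants removed that stem from the
  choice of \<open>\<gamma>\<close>.
\<close>

definition kernel_poly :: "nat \<Rightarrow> complex poly" where
  "kernel_poly n = (if \<gamma> n = alpha_poles \<alpha> n
     then smult (varsigma \<alpha> n / of_real (beta_scale \<alpha> \<gamma> n)) (poly_star n (numer_poly \<gamma> \<phi> n))
     else smult (1 / of_real (beta_scale \<alpha> \<gamma> n)) (numer_poly \<gamma> \<phi> n))"

lemma degree_kernel_poly: "degree (kernel_poly n) \<le> n"
  unfolding kernel_poly_def using numer_poly_props(1)[of n] degree_poly_star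
  by (auto intro: order_trans[OF degree_smult_le])

lemma norm_kernel_poly:
  assumes "cmod z = 1"
  shows "cmod (poly (kernel_poly n) z) = cmod (poly (numer_poly \<gamma> \<phi> n) z) / \<bar>beta_scale \<alpha> \<gamma> n\<bar>"
  unfolding kernel_poly_def
  using norm_poly_poly_star_unit[OF numer_poly_props(1) assms, of n] norm_varsigma[of \<alpha> n]
  by (simp add: norm_mult norm_divide)

lemma kernel_poly_normalized: "weighted_inner \<mu> \<alpha> n (kernel_poly n) (kernel_poly n) = 1"
proof -
  have "weighted_inner \<mu> \<alpha> n (kernel_poly n) (kernel_poly n)
    = complex_of_real (LINT z|\<mu>. (cmod (poly (kernel_poly n) z))\<^sup>2 / (cmod (pole_denom \<alpha> n z))\<^sup>2)"
    by (rule weighted_inner_self)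
  also have "(LINT z|\<mu>. (cmod (poly (kernel_poly n) z))\<^sup>2 / (cmod (pole_denom \<alpha> n z))\<^sup>2) = (LINT z|\<mu>. (cmod (\<phi> n z))\<^sup>2)"
  proof (rule Bochner_Integration.integral_cong[OF refl])
    fix z assume "z \<in> space \<mu>"
    then have z: "cmod z = 1" using space_\<mu> by simp
    have "cmod (pole_denom \<alpha> n z) \<noteq> 0" using pole_denom_nonzero[of z n] z by simp
    moreover have "cmod (poly (kernel_poly n) z) = cmod (\<phi> n z) * cmod (pole_denom \<alpha> n z)"
      using norm_kernel_poly[OF z, of n] numer_poly_props(2)[OF regular_point_circle[OF z], of n]
        norm_varpi_prod[OF z, of n] beta_scale_nonzero[of \<alpha> \<gamma> n] by (simp add: norm_mult)
    ultimately show "(cmod (poly (kernel_poly n) z))\<^sup>2 / (cmod (pole_denom \<alpha> n z))\<^sup>2 = (cmod (\<phi> n z))\<^sup>2"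
      by (simp add: power_mult_distrib)
  qed
  also have "(LINT z|\<mu>. (cmod (\<phi> n z))\<^sup>2) = 1"
  proof (cases "n = 0")
    case True
    interpret prob_space \<mu> by (rule prob_space_\<mu>)
    show ?thesis unfolding True phi_0 by (simp add: prob_space)
  next
    case False
    have "inner_prod \<mu> (\<phi> n) (\<phi> n) = complex_of_real (LINT z|\<mu>. (cmod (\<phi> n z))\<^sup>2)"
      unfolding inner_prod_def
      by (subst integral_complex_of_real[symmetric], rule Bochner_Integration.integral_cong[OF refl])
         (simp only: complex_norm_square mult.commute)
    moreover have "norm_fun \<mu> (\<phi> n) = 1"
      using orf False by (auto simp: orf_gamma_def orthonormal_functions_def)
    ultimately show ?thesis by (simp add: norm_fun_def)
  qed
  finally show ?thesis by simp
qed

text \<open>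
  A polynomial \<open>(z - \<alpha> n) r\<close> is, up to a constant, the numerator of an element of the preceding space
  when \<open>\<gamma> n = \<beta> n\<close>, because then \<open>z - \<alpha> n\<close> is the newest denominator factor. When \<open>\<gamma> n = \<alpha> n\<close> its
  reversal is such a numerator; reversal preserves the scalar product up to conjugation.
\<close>

lemma kernel_poly_orthogonal:
  assumes f: "degree f \<le> n" "poly f (\<alpha> n) = 0"
  shows "weighted_inner \<mu> \<alpha> n f (kernel_poly n) = 0"
proof (cases n)
  case 0
  then obtain c where "f = [:c:]" using f by (auto elim: degree_eq_zeroE)
  then have "f = 0" using f by simp
  then show ?thesis by (simp add: weighted_inner_def)
next
  case (Suc m)
  define a where "a = \<alpha> n"
  define s where "s = complex_of_real (beta_scale \<alpha> \<gamma> n)"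
  have s: "s \<noteq> 0" "cnj s = s" by (simp_all add: s_def beta_scale_nonzero)
  obtain r where r: "degree r \<le> m" "f = [:- a, 1:] * r"
    using linear_factor_obtain f Suc a_def by metis
  have orth: "inner_prod \<mu> F (\<phi> n) = 0" if "F \<in> lspace (blaschke_gamma \<alpha> \<gamma>) m" for F
    using orf that Suc by (auto simp: orf_gamma_def orthonormal_functions_def)
  have weight: "cnj (varpi_prod \<gamma> n z) * varpi_prod \<gamma> n z / of_real ((cmod (pole_denom \<alpha> n z))\<^sup>2) = s\<^sup>2"
    if "cmod z = 1" for z
    using weight_varpi_prod[OF that, of n] pole_denom_nonzero[of z n] that by (simp add: s_def)
  show ?thesis
  proof (cases "\<gamma> n = alpha_poles \<alpha> n")
    case True
    obtain F where F: "F \<in> lspace (blaschke_gamma \<alpha> \<gamma>) m"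
      "\<And>z. regular_point \<alpha> m z \<Longrightarrow> poly (poly_star m r) z = F z * varpi_prod \<gamma> m z"
      using numerator_lspace[OF degree_poly_star] by blast
    have "weighted_inner \<mu> \<alpha> n f (kernel_poly n) = (LINT z|\<mu>. varsigma \<alpha> n * s * cnj (cnj (F z) * \<phi> n z))"
      unfolding weighted_inner_def
    proof (rule Bochner_Integration.integral_cong[OF refl])
      fix z assume "z \<in> space \<mu>"
      then have z: "cmod z = 1" using space_\<mu> by simp
      have "poly (poly_star n f) z = poly [:1, - cnj a:] z * (F z * varpi_prod \<gamma> m z)"
        unfolding r(2) Suc poly_star_root_mult[OF r(1)] poly_mult
        using F(2) regular_point_circle[OF z] by simp
      also have "\<dots> = F z * varpi_prod \<gamma> n z"
        using True by (simp add: Suc varpi_prod_Suc alpha_poles_def a_def)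
      finally have fs: "z ^ n * cnj (poly f z) = F z * varpi_prod \<gamma> n z"
        using poly_poly_star_unit[OF f(1) z] by simp
      have "poly (kernel_poly n) z = varsigma \<alpha> n / s * (z ^ n * cnj (\<phi> n z * varpi_prod \<gamma> n z))"
        using True poly_poly_star_unit[OF numer_poly_props(1) z] numer_poly_props(2)[OF regular_point_circle[OF z]]
        by (simp add: kernel_poly_def s_def)
      then have "cnj (poly f z) * poly (kernel_poly n) z
        = varsigma \<alpha> n / s * (z ^ n * cnj (poly f z)) * cnj (\<phi> n z * varpi_prod \<gamma> n z)" by simp
      also have "\<dots> = varsigma \<alpha> n / s * cnj (cnj (F z) * \<phi> n z) * (cnj (varpi_prod \<gamma> n z) * varpi_prod \<gamma> n z)"
        unfolding fs by simp
      finally have "cnj (poly f z) * poly (kernel_poly n) z / of_real ((cmod (pole_denom \<alpha> n z))\<^sup>2)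
        = varsigma \<alpha> n / s * cnj (cnj (F z) * \<phi> n z) * s\<^sup>2"
        using weight[OF z] by (metis times_divide_eq_right)
      then show "cnj (poly f z) * poly (kernel_poly n) z / of_real ((cmod (pole_denom \<alpha> n z))\<^sup>2)
        = varsigma \<alpha> n * s * cnj (cnj (F z) * \<phi> n z)"
        using s by (simp add: power2_eq_square)
    qed
    also have "\<dots> = varsigma \<alpha> n * s * cnj (inner_prod \<mu> F (\<phi> n))"
      by (simp only: integral_mult_right_zero Bochner_Integration.integral_cnj inner_prod_def)
    finally show ?thesis using orth[OF F(1)] by simp
  next
    case False
    then have b: "\<gamma> n = beta_poles \<alpha> n" using gamma_iff by blast
    define k where "k = sigma \<alpha> n / of_real (pole_scale \<alpha> n)"
    have k: "k \<noteq> 0" using sigma_nonzero pole_scale_nonzero by (simp add: k_def)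
    obtain F where F: "F \<in> lspace (blaschke_gamma \<alpha> \<gamma>) m"
      "\<And>z. regular_point \<alpha> m z \<Longrightarrow> poly r z = F z * varpi_prod \<gamma> m z"
      using numerator_lspace[OF r(1)] by blast
    have "weighted_inner \<mu> \<alpha> n f (kernel_poly n) = (LINT z|\<mu>. s / cnj k * (cnj (F z) * \<phi> n z))"
      unfolding weighted_inner_def
    proof (rule Bochner_Integration.integral_cong[OF refl])
      fix z assume "z \<in> space \<mu>"
      then have z: "cmod z = 1" using space_\<mu> by simp
      have v: "varpi_prod \<gamma> n z = varpi_prod \<gamma> m z * (k * (z - a))"
        by (simp add: Suc varpi_prod_Suc b[unfolded Suc] varpi_beta k_def a_def)
      have "poly f z = (z - a) * (F z * varpi_prod \<gamma> m z)"
        unfolding r(2) poly_mult F(2)[OF regular_point_circle[OF z]] by simp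
      then have "poly f z = F z * varpi_prod \<gamma> n z / k"
        unfolding v using k by simp
      moreover have "poly (kernel_poly n) z = 1 / s * (\<phi> n z * varpi_prod \<gamma> n z)"
        using False numer_poly_props(2)[OF regular_point_circle[OF z]] by (simp add: kernel_poly_def s_def)
      ultimately have "cnj (poly f z) * poly (kernel_poly n) z
        = 1 / (cnj k * s) * (cnj (F z) * \<phi> n z) * (cnj (varpi_prod \<gamma> n z) * varpi_prod \<gamma> n z)" by simp
      then have "cnj (poly f z) * poly (kernel_poly n) z / of_real ((cmod (pole_denom \<alpha> n z))\<^sup>2)
        = 1 / (cnj k * s) * (cnj (F z) * \<phi> n z) * s\<^sup>2"
        using weight[OF z] by (metis times_divide_eq_right)
      then show "cnj (poly f z) * poly (kernel_poly n) z / of_real ((cmod (pole_denom \<alpha> n z))\<^sup>2)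
        = s / cnj k * (cnj (F z) * \<phi> n z)"
        using s by (simp add: power2_eq_square)
    qed
    also have "\<dots> = s / cnj k * inner_prod \<mu> F (\<phi> n)"
      by (simp only: integral_mult_right_zero inner_prod_def)
    finally show ?thesis using orth[OF F(1)] by simp
  qed
qed

lemma zeta_alpha_reflect:
  assumes "z \<noteq> 0" "z \<noteq> \<alpha> j" "1 - cnj (\<alpha> j) * z \<noteq> 0"
  shows "zeta \<alpha> (alpha_poles \<alpha>) j z * cnj (zeta \<alpha> (alpha_poles \<alpha>) j (1 / cnj z)) = 1"
proof -
  have sig: "sigma \<alpha> j * cnj (sigma \<alpha> j) = 1"
    using norm_sigma[of \<alpha> j] by (simp add: complex_norm_square[symmetric])
  have "cnj (zeta \<alpha> (alpha_poles \<alpha>) j (1 / cnj z)) = cnj (sigma \<alpha> j) * ((1 / z - cnj (\<alpha> j)) / (1 - \<alpha> j * (1 / z)))"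
    by (simp add: zeta_alpha)
  also have "(1 / z - cnj (\<alpha> j)) / (1 - \<alpha> j * (1 / z)) = (1 - cnj (\<alpha> j) * z) / (z - \<alpha> j)"
    using assms(1,2) by (simp add: divide_simps)
  finally have "zeta \<alpha> (alpha_poles \<alpha>) j z * cnj (zeta \<alpha> (alpha_poles \<alpha>) j (1 / cnj z))
    = (sigma \<alpha> j * cnj (sigma \<alpha> j)) * ((z - \<alpha> j) / (1 - cnj (\<alpha> j) * z) * ((1 - cnj (\<alpha> j) * z) / (z - \<alpha> j)))"
    by (simp add: zeta_alpha)
  then show ?thesis using assms sig by simp
qed

lemma zeta_beta_inverse: "zeta \<alpha> (beta_poles \<alpha>) j z = inverse (zeta \<alpha> (alpha_poles \<alpha>) j z)"
  by (simp add: zeta_alpha zeta_beta)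

lemma blaschke_dot_reflect:
  assumes "regular_point \<alpha> n z" and \<nu>: "\<nu> = alpha_poles \<alpha> \<or> \<nu> = beta_poles \<alpha>"
  shows "blaschke_dot \<alpha> \<gamma> \<nu> n z * cnj (blaschke_dot \<alpha> \<gamma> \<nu> n (1 / cnj z)) = 1"
proof -
  have "zeta \<alpha> \<nu> j z * cnj (zeta \<alpha> \<nu> j (1 / cnj z)) = 1" if "j \<in> {1..n}" for j
  proof -
    have "zeta \<alpha> (alpha_poles \<alpha>) j z * cnj (zeta \<alpha> (alpha_poles \<alpha>) j (1 / cnj z)) = 1"
      using assms(1) that by (intro zeta_alpha_reflect) (auto simp: regular_point_def)
    moreover from this have "zeta \<alpha> (beta_poles \<alpha>) j z * cnj (zeta \<alpha> (beta_poles \<alpha>) j (1 / cnj z)) = 1"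
      unfolding zeta_beta_inverse complex_cnj_inverse by (metis inverse_mult_distrib inverse_1)
    ultimately show ?thesis using \<nu> by blast
  qed
  then show ?thesis
    unfolding blaschke_dot_if cnj_prod prod.distrib[symmetric] by (intro prod.neutral) auto
qed

text \<open>
  The normalization of \<open>\<phi> n\<close> is a condition on the limit of the left-hand side; the right-hand
  side is continuous at \<open>\<alpha> n\<close>. The computation rests on the fact that a Blaschke product and its
  reflection in the circle are inverse to each other.
\<close>

lemma recip_at_alpha:
  assumes "regular_point \<alpha> n z" and "\<gamma> n = alpha_poles \<alpha> n"
  shows "recip_gamma \<alpha> \<gamma> \<phi> n z / blaschke_dot \<alpha> \<gamma> (beta_poles \<alpha>) n z
    = poly (kernel_poly n) z / pole_denom \<alpha> n z"
proof -
  define w where "w = 1 / cnj z"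
  have w: "regular_point \<alpha> n w" unfolding w_def by (rule regular_point_reflect[OF assms(1)])
  have z0: "z \<noteq> 0" using assms(1) by (simp add: regular_point_def)
  define s where "s = complex_of_real (beta_scale \<alpha> \<gamma> n)"
  have s: "s \<noteq> 0" "cnj s = s" by (simp_all add: s_def beta_scale_nonzero)
  let ?A = "blaschke_dot \<alpha> \<gamma> (alpha_poles \<alpha>) n" and ?B = "blaschke_dot \<alpha> \<gamma> (beta_poles \<alpha>) n"
  have B: "?B z \<noteq> 0" using blaschke_dot_reflect[OF assms(1), of "beta_poles \<alpha>"] by auto
  have A: "?A z * cnj (?A w) = 1"
    unfolding w_def using blaschke_dot_reflect[OF assms(1), of "alpha_poles \<alpha>"] by simp
  then have Aw: "?A w \<noteq> 0" by auto
  have "recip_gamma \<alpha> \<gamma> \<phi> n z / ?B z = ?A z * cnj (\<phi> n w)"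
    using B by (simp add: recip_gamma_def substar_def w_def)
  also have "\<dots> = cnj (\<phi> n w / ?A w)"
    using A Aw by (simp add: field_simps)
  also have "\<phi> n w / ?A w = poly (numer_poly \<gamma> \<phi> n) w / (varsigma \<alpha> n * s * poly (node_poly \<alpha> n) w)"
    unfolding numer_poly_props(2)[OF w] poly_node_poly s_def blaschke_dot_alpha[OF w, symmetric]
    using varpi_prod_nonzero[OF w] by simp
  also have "cnj \<dots> = cnj (poly (numer_poly \<gamma> \<phi> n) w) / (cnj (varsigma \<alpha> n) * s * cnj (poly (node_poly \<alpha> n) w))"
    by (simp add: s)
  \<comment> \<open>Multiplying both parts by \<open>z ^ n\<close> turns the reflected polynomials into reversed ones.\<close>
  also have "\<dots> = z ^ n * cnj (poly (numer_poly \<gamma> \<phi> n) w) / (cnj (varsigma \<alpha> n) * s * (z ^ n * cnj (poly (node_poly \<alpha> n) w)))"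
    using z0 by simp
  also have "\<dots> = poly (poly_star n (numer_poly \<gamma> \<phi> n)) z / (cnj (varsigma \<alpha> n) * s * pole_denom \<alpha> n z)"
    using poly_poly_star[OF numer_poly_props(1) z0] poly_poly_star[OF degree_node_poly[of \<alpha> n] z0]
    by (simp add: w_def poly_star_node_poly poly_denom_poly)
  also have "\<dots> = varsigma \<alpha> n / s * poly (poly_star n (numer_poly \<gamma> \<phi> n)) z / pole_denom \<alpha> n z"
    by (simp add: cnj_varsigma)
  also have "\<dots> = poly (kernel_poly n) z / pole_denom \<alpha> n z"
    using assms(2) by (simp add: kernel_poly_def s_def)
  finally show ?thesis .
qed

lemma recip_at_beta:
  assumes "regular_point \<alpha> n z" and "\<gamma> n = beta_poles \<alpha> n"
  shows "recip_gamma \<alpha> \<gamma> \<phi> n z / blaschke_dot \<alpha> \<gamma> (alpha_poles \<alpha>) n z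
    = cnj (poly (kernel_poly n) (1 / cnj z) / pole_denom \<alpha> n (1 / cnj z))"
proof -
  define w where "w = 1 / cnj z"
  have w: "regular_point \<alpha> n w" unfolding w_def by (rule regular_point_reflect[OF assms(1)])
  define s where "s = complex_of_real (beta_scale \<alpha> \<gamma> n)"
  let ?A = "blaschke_dot \<alpha> \<gamma> (alpha_poles \<alpha>) n" and ?B = "blaschke_dot \<alpha> \<gamma> (beta_poles \<alpha>) n"
  have A: "?A z \<noteq> 0" using blaschke_dot_reflect[OF assms(1), of "alpha_poles \<alpha>"] by auto
  have B: "?B z * cnj (?B w) = 1"
    unfolding w_def using blaschke_dot_reflect[OF assms(1), of "beta_poles \<alpha>"] by simp
  then have Bw: "?B w \<noteq> 0" by auto
  have "recip_gamma \<alpha> \<gamma> \<phi> n z / ?A z = ?B z * cnj (\<phi> n w)"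
    using A by (simp add: recip_gamma_def substar_def w_def)
  also have "\<dots> = cnj (\<phi> n w / ?B w)"
    using B Bw by (simp add: field_simps)
  also have "\<phi> n w / ?B w = poly (numer_poly \<gamma> \<phi> n) w / (s * pole_denom \<alpha> n w)"
    unfolding numer_poly_props(2)[OF w] s_def blaschke_dot_beta[OF w, symmetric]
    using varpi_prod_nonzero[OF w] by simp
  also have "\<dots> = poly (kernel_poly n) w / pole_denom \<alpha> n w"
    using assms(2) gamma_iff[of n] by (simp add: kernel_poly_def s_def)
  finally show ?thesis by (simp add: w_def)
qed

text \<open>
  For \<open>\<gamma> n = \<beta> n\<close> the normalization concerns the limit at \<open>\<beta> n\<close>, possibly at infinity; reflection in
  the circle moves it to \<open>\<alpha> n\<close> and conjugates the limit, which is real.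
\<close>

lemma kernel_poly_positive:
  "\<exists>r::real. r > 0 \<and> poly (kernel_poly n) (\<alpha> n) = complex_of_real r * pole_denom \<alpha> n (\<alpha> n)"
proof (cases "n = 0")
  case True
  have "numer_poly \<gamma> \<phi> 0 = 1"
    by (rule poly_eqI_unit_circle)
       (simp add: numer_poly_props(2) regular_point_circle phi_0 varpi_prod_def)
  then have "kernel_poly 0 = 1"
    by (simp add: kernel_poly_def varsigma_def beta_scale_def poly_star_def one_pCons monom_0)
  then show ?thesis unfolding True by (intro exI[of _ 1]) (simp add: pole_denom_def)
next
  case False
  have nz: "pole_denom \<alpha> n (\<alpha> n) \<noteq> 0" using in_disk[of n] by (simp add: pole_denom_nonzero)
  let ?q = "\<lambda>z. poly (kernel_poly n) z / pole_denom \<alpha> n z"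
  have cont: "(?q \<longlongrightarrow> ?q (\<alpha> n)) (at (\<alpha> n))"
    using nz continuous_pole_denom[of UNIV n]
    by (intro tendsto_intros) (auto simp: continuous_on_def)
  have regular: "eventually (regular_point \<alpha> n) (punctured_nhds v)" for v
    using eventually_punctured_nhds_finite[OF finite_not_regular] by simp
  have "\<exists>r::real. r > 0 \<and> ?q (\<alpha> n) = complex_of_real r"
  proof (cases "\<gamma> n = alpha_poles \<alpha> n")
    case True
    then have "positive_value_at (\<lambda>z. recip_gamma \<alpha> \<gamma> \<phi> n z / blaschke_dot \<alpha> \<gamma> (beta_poles \<alpha>) n z) (alpha_poles \<alpha> n)"
      using orf False by (simp add: orf_gamma_def)
    then obtain r :: real where r: "r > 0"
      "((\<lambda>z. recip_gamma \<alpha> \<gamma> \<phi> n z / blaschke_dot \<alpha> \<gamma> (beta_poles \<alpha>) n z) \<longlongrightarrow> complex_of_real r) (at (\<alpha> n))"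
      by (auto simp: positive_value_at_def alpha_poles_def)
    have "eventually (\<lambda>z. recip_gamma \<alpha> \<gamma> \<phi> n z / blaschke_dot \<alpha> \<gamma> (beta_poles \<alpha>) n z = ?q z) (at (\<alpha> n))"
      using regular[of "Fin (\<alpha> n)"] recip_at_alpha[OF _ True] by (auto elim: eventually_mono)
    then have "(?q \<longlongrightarrow> complex_of_real r) (at (\<alpha> n))" by (rule tendsto_cong[THEN iffD1, OF _ r(2)])
    then have "?q (\<alpha> n) = complex_of_real r" using tendsto_unique[OF _ cont] by simp
    then show ?thesis using r by blast
  next
    case alpha: False
    then have b: "\<gamma> n = beta_poles \<alpha> n" using gamma_iff by blast
    let ?F = "punctured_nhds (beta_poles \<alpha> n)"
    have "positive_value_at (\<lambda>z. recip_gamma \<alpha> \<gamma> \<phi> n z / blaschke_dot \<alpha> \<gamma> (alpha_poles \<alpha>) n z) (beta_poles \<alpha> n)"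
      using orf False b by (simp add: orf_gamma_def)
    then obtain r :: real where r: "r > 0"
      "((\<lambda>z. recip_gamma \<alpha> \<gamma> \<phi> n z / blaschke_dot \<alpha> \<gamma> (alpha_poles \<alpha>) n z) \<longlongrightarrow> complex_of_real r) ?F"
      by (auto simp: positive_value_at_def)
    have "eventually (\<lambda>z. recip_gamma \<alpha> \<gamma> \<phi> n z / blaschke_dot \<alpha> \<gamma> (alpha_poles \<alpha>) n z = cnj (?q (1 / cnj z))) ?F"
      using regular[of "beta_poles \<alpha> n"] recip_at_beta[OF _ b] by (auto elim: eventually_mono)
    then have "((\<lambda>z. cnj (?q (1 / cnj z))) \<longlongrightarrow> complex_of_real r) ?F" by (rule tendsto_cong[THEN iffD1, OF _ r(2)])
    moreover have "((\<lambda>z. cnj (?q (1 / cnj z))) \<longlongrightarrow> cnj (?q (\<alpha> n))) ?F"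
    proof -
      have "isCont ?q (\<alpha> n)" using cont by (simp add: isCont_def)
      then show ?thesis by (intro tendsto_cnj isCont_tendsto_compose[OF _ reflection_tendsto])
    qed
    ultimately have "cnj (?q (\<alpha> n)) = complex_of_real r"
      using tendsto_unique[OF punctured_nhds_neq_bot] by blast
    then have "?q (\<alpha> n) = complex_of_real r" by (metis complex_cnj_cnj complex_cnj_complex_of_real)
    then show ?thesis using r by blast
  qed
  then show ?thesis using nz by (auto simp: divide_eq_eq)
qed

lemma szego_kernel_kernel_poly: "szego_kernel \<mu> \<alpha> n (kernel_poly n)"
  unfolding szego_kernel_def
  using degree_kernel_poly kernel_poly_orthogonal kernel_poly_normalized kernel_poly_positive by blast

lemma numer_poly_alpha:
  assumes "szego_kernel \<mu> \<alpha> n H" "\<gamma> n = alpha_poles \<alpha> n"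
  shows "numer_poly \<gamma> \<phi> n = smult (varsigma \<alpha> n * of_real (beta_scale \<alpha> \<gamma> n)) (poly_star n H)"
proof -
  have "H = kernel_poly n" using szego_kernel_unique[OF assms(1) szego_kernel_kernel_poly] .
  then have "poly_star n H = smult (cnj (varsigma \<alpha> n) / of_real (beta_scale \<alpha> \<gamma> n)) (numer_poly \<gamma> \<phi> n)"
    using assms(2) numer_poly_props(1)[of n] by (simp add: kernel_poly_def poly_star_smult poly_star_poly_star)
  then show ?thesis using varsigma_cnj[of \<alpha> n] beta_scale_nonzero[of \<alpha> \<gamma> n] by simp
qed

lemma numer_poly_beta:
  assumes "szego_kernel \<mu> \<alpha> n H" "\<gamma> n = beta_poles \<alpha> n"
  shows "numer_poly \<gamma> \<phi> n = smult (of_real (beta_scale \<alpha> \<gamma> n)) H"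
proof -
  have "H = kernel_poly n" using szego_kernel_unique[OF assms(1) szego_kernel_kernel_poly] .
  then show ?thesis
    using assms(2) gamma_iff[of n] beta_scale_nonzero[of \<alpha> \<gamma> n] by (simp add: kernel_poly_def)
qed

end

section \<open>The parameters\<close>

text \<open>
  The parameter of the pure \<open>\<alpha>\<close> family in terms of the kernel polynomials \<open>K\<close> of index \<open>n - 1\<close> and \<open>H\<close>
  of index \<open>n\<close>.
\<close>

definition reflection_coeff ::
  "(nat \<Rightarrow> complex) \<Rightarrow> complex poly \<Rightarrow> complex poly \<Rightarrow> nat \<Rightarrow> complex" where
  "reflection_coeff \<alpha> K H n =
     (let a = \<alpha> (n - 1)
      in cnj (varsigma \<alpha> (n - 2)) * (varsigma \<alpha> (n - 1))\<^sup>2 * (cnj (poly K a) / poly K a)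
           * (poly (poly_star n H) a / cnj (poly H a)))"

text \<open>
  The pole \<open>\<beta> j\<close>, with \<open>1\<close> in place of infinity: the value at infinity of a polynomial of formal
  degree \<open>n\<close> is its coefficient of \<open>z ^ n\<close>, so no power of the point occurs.
\<close>

definition beta_point :: "(nat \<Rightarrow> complex) \<Rightarrow> nat \<Rightarrow> complex" where
  "beta_point \<alpha> j = (if \<alpha> j = 0 then 1 else 1 / cnj (\<alpha> j))"

lemma poly_at_beta:
  assumes "degree p \<le> n"
  shows "poly_at n p (beta_poles \<alpha> j) = beta_point \<alpha> j ^ n * cnj (poly (poly_star n p) (\<alpha> j))"
proof (cases "\<alpha> j = 0")
  case True
  then show ?thesis by (simp add: beta_poles_def beta_point_def poly_0_coeff_0 coeff_poly_star)
next
  case False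
  then show ?thesis
    using poly_poly_star[OF assms False]
    by (simp add: beta_poles_def beta_point_def inverse_eq_divide power_divide)
qed

lemma beta_point_nonzero: "beta_point \<alpha> j \<noteq> 0"
  by (simp add: beta_point_def)

lemma beta_point_phase: "beta_point \<alpha> j / cnj (beta_point \<alpha> j) = (cnj (sigma \<alpha> j))\<^sup>2"
proof (cases "\<alpha> j = 0")
  case False
  have "(complex_of_real (cmod (\<alpha> j)))\<^sup>2 = \<alpha> j * cnj (\<alpha> j)"
    using complex_norm_square[of "\<alpha> j"] by simp
  then have "(cnj (sigma \<alpha> j))\<^sup>2 = (\<alpha> j)\<^sup>2 / (\<alpha> j * cnj (\<alpha> j))"
    using False by (simp add: sigma_def power_divide)
  also have "\<dots> = \<alpha> j / cnj (\<alpha> j)" using False by (simp add: power2_eq_square)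
  finally show ?thesis using False by (simp add: beta_point_def)
qed (simp add: beta_point_def sigma_def)

context disk_poles
begin

text \<open>
  For \<open>n = 1\<close> both indices are \<open>0\<close>; the identity persists because \<open>\<alpha> 0 = 0\<close> makes the extra factor \<open>1\<close>.
\<close>

lemma varsigma_pred:
  assumes "n \<ge> 1"
  shows "varsigma \<alpha> (n - 1) = varsigma \<alpha> (n - 2) * sigma \<alpha> (n - 1)"
proof (cases "n = 1")
  case True
  then show ?thesis by (simp add: varsigma_def sigma_def alpha_0)
next
  case False
  then have "n - 1 = Suc (n - 2)" using assms by linarith
  then show ?thesis by (simp only:) (simp add: varsigma_def)
qed

text \<open>
  The phase of \<open>\<beta> (n - 1)\<close> accounts exactly for the difference between the unimodular prefactors of
  the \<open>\<alpha>\<close> and \<open>\<beta>\<close> parameters; this explains the index \<open>n - 2\<close> in their definition.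
\<close>

lemma beta_phase:
  assumes "n \<ge> 1"
  shows "cnj (varsigma \<alpha> (n - 2)) * (beta_point \<alpha> (n - 1) / cnj (beta_point \<alpha> (n - 1)))
    = varsigma \<alpha> (n - 2) * (cnj (varsigma \<alpha> (n - 1)))\<^sup>2"
  unfolding beta_point_phase varsigma_pred[OF assms] complex_cnj_mult power_mult_distrib cnj_varsigma
  using varsigma_nonzero[of \<alpha> "n - 2"] by (simp add: power2_eq_square)

lemma norm_reflection_coeff:
  assumes "szego_kernel \<mu> \<alpha> (n - 1) K" "szego_kernel \<mu> \<alpha> n H" "n \<ge> 1"
  shows "cmod (reflection_coeff \<alpha> K H n) < 1"
proof -
  have "cmod (poly K (\<alpha> (n - 1))) \<noteq> 0"
    using szego_kernel_nonzero_at[OF assms(1)] by simp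
  moreover have "cmod (poly (poly_star n H) (\<alpha> (n - 1))) < cmod (poly H (\<alpha> (n - 1)))"
    using szego_kernel_dominates[OF assms(2,3) in_disk] .
  ultimately show ?thesis
    by (simp add: reflection_coeff_def Let_def norm_mult norm_divide norm_power norm_varsigma divide_less_eq)
qed

end

context mixed_orf
begin

lemma numer_poly_alpha_values:
  assumes "szego_kernel \<mu> \<alpha> n H" "\<gamma> n = alpha_poles \<alpha> n"
  defines "p \<equiv> numer_poly \<gamma> \<phi> n" and "v \<equiv> varsigma \<alpha> n"
    and "s \<equiv> complex_of_real (beta_scale \<alpha> \<gamma> n)"
  shows "poly_at n p (alpha_poles \<alpha> j) = v * s * poly (poly_star n H) (\<alpha> j)"
    and "poly_at n (poly_star n p) (alpha_poles \<alpha> j) = cnj v * s * poly H (\<alpha> j)"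
    and "poly_at n p (beta_poles \<alpha> j) = beta_point \<alpha> j ^ n * (cnj (cnj v * s * poly H (\<alpha> j)))"
    and "poly_at n (poly_star n p) (beta_poles \<alpha> j)
      = beta_point \<alpha> j ^ n * (cnj (v * s * poly (poly_star n H) (\<alpha> j)))"
proof -
  have deg: "degree H \<le> n" "degree p \<le> n"
    using assms(1) numer_poly_props(1) by (simp_all add: szego_kernel_def p_def)
  have p: "p = smult (v * s) (poly_star n H)"
    using numer_poly_alpha[OF assms(1,2)] by (simp add: p_def v_def s_def)
  have p': "poly_star n p = smult (cnj v * s) H"
    using deg by (simp add: p poly_star_smult poly_star_poly_star s_def)
  show "poly_at n p (alpha_poles \<alpha> j) = v * s * poly (poly_star n H) (\<alpha> j)"
    "poly_at n (poly_star n p) (alpha_poles \<alpha> j) = cnj v * s * poly H (\<alpha> j)"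
    unfolding p' by (simp_all add: p alpha_poles_def)
  show "poly_at n p (beta_poles \<alpha> j) = beta_point \<alpha> j ^ n * (cnj (cnj v * s * poly H (\<alpha> j)))"
    unfolding poly_at_beta[OF deg(2)] p' by simp
  show "poly_at n (poly_star n p) (beta_poles \<alpha> j)
      = beta_point \<alpha> j ^ n * (cnj (v * s * poly (poly_star n H) (\<alpha> j)))"
    unfolding poly_at_beta[OF degree_poly_star] poly_star_poly_star[OF deg(2)] by (simp add: p)
qed

lemma numer_poly_beta_values:
  assumes "szego_kernel \<mu> \<alpha> n H" "\<gamma> n = beta_poles \<alpha> n"
  defines "p \<equiv> numer_poly \<gamma> \<phi> n" and "s \<equiv> complex_of_real (beta_scale \<alpha> \<gamma> n)"
  shows "poly_at n p (alpha_poles \<alpha> j) = s * poly H (\<alpha> j)"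
    and "poly_at n (poly_star n p) (alpha_poles \<alpha> j) = s * poly (poly_star n H) (\<alpha> j)"
    and "poly_at n p (beta_poles \<alpha> j) = beta_point \<alpha> j ^ n * (s * cnj (poly (poly_star n H) (\<alpha> j)))"
    and "poly_at n (poly_star n p) (beta_poles \<alpha> j) = beta_point \<alpha> j ^ n * (s * cnj (poly H (\<alpha> j)))"
proof -
  have deg: "degree p \<le> n" using numer_poly_props(1) by (simp add: p_def)
  have p: "p = smult s H"
    using numer_poly_beta[OF assms(1,2)] by (simp add: p_def s_def)
  have p': "poly_star n p = smult s (poly_star n H)" by (simp add: p poly_star_smult s_def)
  show "poly_at n p (alpha_poles \<alpha> j) = s * poly H (\<alpha> j)"
    "poly_at n (poly_star n p) (alpha_poles \<alpha> j) = s * poly (poly_star n H) (\<alpha> j)"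
    unfolding p' by (simp_all add: p alpha_poles_def)
  show "poly_at n p (beta_poles \<alpha> j) = beta_point \<alpha> j ^ n * (s * cnj (poly (poly_star n H) (\<alpha> j)))"
    unfolding poly_at_beta[OF deg] p' by (simp add: s_def)
  show "poly_at n (poly_star n p) (beta_poles \<alpha> j) = beta_point \<alpha> j ^ n * (s * cnj (poly H (\<alpha> j)))"
    unfolding poly_at_beta[OF degree_poly_star] poly_star_poly_star[OF deg] by (simp add: p s_def)
qed

text \<open>
  The choice at \<open>n\<close> decides whether \<open>H\<close> or its reversal is in the numerator, the choice at \<open>n - 1\<close>
  whether values are taken at \<open>\<alpha> (n - 1)\<close> or reflected; only the combined effect on the quotient matters.
  In the mixed cases the parameter is infinite exactly when the reversal of \<open>H\<close> vanishes at
  \<open>\<alpha> (n - 1)\<close>, that is, when the number being inverted is \<open>0\<close>.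
\<close>

lemma lambda_param_cases:
  assumes n: "n \<ge> 1" and K: "szego_kernel \<mu> \<alpha> (n - 1) K" and H: "szego_kernel \<mu> \<alpha> n H"
  shows "\<gamma> n = alpha_poles \<alpha> n \<Longrightarrow> \<gamma> (n - 1) = alpha_poles \<alpha> (n - 1) \<Longrightarrow>
      lambda_param \<alpha> \<gamma> \<phi> n = Fin (reflection_coeff \<alpha> K H n)"
    and "\<gamma> n = beta_poles \<alpha> n \<Longrightarrow> \<gamma> (n - 1) = beta_poles \<alpha> (n - 1) \<Longrightarrow>
      lambda_param \<alpha> \<gamma> \<phi> n = Fin (cnj (reflection_coeff \<alpha> K H n))"
    and "\<gamma> n = alpha_poles \<alpha> n \<Longrightarrow> \<gamma> (n - 1) = beta_poles \<alpha> (n - 1) \<Longrightarrow>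
      lambda_param \<alpha> \<gamma> \<phi> n = einverse (Fin (reflection_coeff \<alpha> K H n))"
    and "\<gamma> n = beta_poles \<alpha> n \<Longrightarrow> \<gamma> (n - 1) = alpha_poles \<alpha> (n - 1) \<Longrightarrow>
      lambda_param \<alpha> \<gamma> \<phi> n = einverse (Fin (cnj (reflection_coeff \<alpha> K H n)))"
proof -
  define a where "a = \<alpha> (n - 1)"
  define b where "b = beta_point \<alpha> (n - 1)"
  define k where "k = poly K a"
  define h where "h = poly H a"
  define c where "c = poly (poly_star n H) a"
  define s where "s = complex_of_real (beta_scale \<alpha> \<gamma> n)"
  define s' where "s' = complex_of_real (beta_scale \<alpha> \<gamma> (n - 1))"
  define v where "v = varsigma \<alpha> n"
  define u where "u = cnj (varsigma \<alpha> (n - 2)) * (varsigma \<alpha> (n - 1))\<^sup>2"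
  let ?p = "numer_poly \<gamma> \<phi> n" and ?p' = "numer_poly \<gamma> \<phi> (n - 1)"
  have s: "s \<noteq> 0" "cnj s = s" "s' \<noteq> 0" "cnj s' = s'"
    by (simp_all add: s_def s'_def beta_scale_nonzero)
  have v: "v \<noteq> 0" by (simp add: v_def varsigma_nonzero)
  have u: "u \<noteq> 0" by (simp add: u_def varsigma_nonzero)
  have b: "b \<noteq> 0" by (simp add: b_def beta_point_nonzero)
  have k: "k \<noteq> 0" using szego_kernel_nonzero_at[OF K] by (simp add: k_def a_def)
  have h: "h \<noteq> 0" using szego_kernel_nonzero_in_disk[OF H in_disk] by (simp add: h_def a_def)
  have R: "reflection_coeff \<alpha> K H n = u * (cnj k / k) * (c / cnj h)"
    by (simp add: reflection_coeff_def Let_def u_def k_def h_def c_def a_def)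
  have phase: "cnj (varsigma \<alpha> (n - 2)) * (b / cnj b) = cnj u"
    using beta_phase[OF n] by (simp add: u_def b_def)
  have uu: "cnj u = 1 / u"
    by (simp add: u_def cnj_varsigma power_one_over)
  have lam: "lambda_param \<alpha> \<gamma> \<phi> n =
      (let d = poly_at n (poly_star n ?p) (\<gamma> (n - 1))
       in if d = 0 then Infty else Fin (eta_param \<alpha> \<gamma> \<phi> n * (poly_at n ?p (\<gamma> (n - 1)) / cnj d)))"
    by (simp add: lambda_param_def Let_def)
  have eta_a: "eta_param \<alpha> \<gamma> \<phi> n = u * (cnj k / k)" if g: "\<gamma> (n - 1) = alpha_poles \<alpha> (n - 1)"
  proof -
    have "poly_at (n - 1) (poly_star (n - 1) ?p') (\<gamma> (n - 1)) = cnj (varsigma \<alpha> (n - 1)) * s' * k"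
      unfolding g numer_poly_alpha_values[OF K g] by (simp only: k_def a_def s'_def)
    then show ?thesis
      using s varsigma_nonzero[of \<alpha> "n - 1"]
      by (simp add: eta_param_def Let_def u_def cnj_varsigma power2_eq_square)
  qed
  have eta_b: "eta_param \<alpha> \<gamma> \<phi> n = cnj (varsigma \<alpha> (n - 2)) * (cnj b / b) ^ (n - 1) * (k / cnj k)"
    if g: "\<gamma> (n - 1) = beta_poles \<alpha> (n - 1)"
  proof -
    have "poly_at (n - 1) (poly_star (n - 1) ?p') (\<gamma> (n - 1)) = b ^ (n - 1) * (s' * cnj k)"
      unfolding g numer_poly_beta_values[OF K g] by (simp only: k_def a_def s'_def b_def)
    then show ?thesis
      using s by (simp add: eta_param_def Let_def power_divide)
  qed
  \<comment> \<open>One power of the phase of \<open>b\<close> survives: \<open>n\<close> from the numerator polynomial against \<open>n - 1\<close> from eta.\<close>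
  have b_pow: "(cnj b / b) ^ (n - 1) * (b ^ n / cnj b ^ n) = b / cnj b"
  proof -
    have "x ^ n = x * x ^ (n - 1)" for x :: complex
      using n by (simp add: power_eq_if)
    then show ?thesis using b by (simp add: power_divide)
  qed
  {
    assume g: "\<gamma> n = alpha_poles \<alpha> n" "\<gamma> (n - 1) = alpha_poles \<alpha> (n - 1)"
    have "poly_at n ?p (\<gamma> (n - 1)) = v * s * c" "poly_at n (poly_star n ?p) (\<gamma> (n - 1)) = cnj v * s * h"
      unfolding g(2) numer_poly_alpha_values[OF H g(1)] by (simp_all only: h_def c_def a_def s_def v_def)
    then show "lambda_param \<alpha> \<gamma> \<phi> n = Fin (reflection_coeff \<alpha> K H n)"
      unfolding lam R eta_a[OF g(2)] using s v h by simp
  next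
    assume g: "\<gamma> n = beta_poles \<alpha> n" "\<gamma> (n - 1) = alpha_poles \<alpha> (n - 1)"
    have "poly_at n ?p (\<gamma> (n - 1)) = s * h" "poly_at n (poly_star n ?p) (\<gamma> (n - 1)) = s * c"
      unfolding g(2) numer_poly_beta_values[OF H g(1)] by (simp_all only: h_def c_def a_def s_def)
    then show "lambda_param \<alpha> \<gamma> \<phi> n = einverse (Fin (cnj (reflection_coeff \<alpha> K H n)))"
      unfolding lam R eta_a[OF g(2)] using s u k h by (simp add: uu)
  next
    assume g: "\<gamma> n = beta_poles \<alpha> n" "\<gamma> (n - 1) = beta_poles \<alpha> (n - 1)"
    have p: "poly_at n ?p (\<gamma> (n - 1)) = b ^ n * (s * cnj c)"
      unfolding g(2) numer_poly_beta_values[OF H g(1)] by (simp only: c_def a_def s_def b_def)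
    have d: "poly_at n (poly_star n ?p) (\<gamma> (n - 1)) = b ^ n * (s * cnj h)"
      unfolding g(2) numer_poly_beta_values[OF H g(1)] by (simp only: h_def a_def s_def b_def)
    have "eta_param \<alpha> \<gamma> \<phi> n * (b ^ n * (s * cnj c) / cnj (b ^ n * (s * cnj h)))
      = cnj (varsigma \<alpha> (n - 2)) * ((cnj b / b) ^ (n - 1) * (b ^ n / cnj b ^ n)) * (k / cnj k) * (cnj c / h)"
      unfolding eta_b[OF g(2)] using s by (simp add: mult_ac)
    also have "\<dots> = cnj (u * (cnj k / k) * (c / cnj h))"
      unfolding b_pow phase by simp
    finally show "lambda_param \<alpha> \<gamma> \<phi> n = Fin (cnj (reflection_coeff \<alpha> K H n))"
      unfolding lam R p d using s b h by simp
  next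
    assume g: "\<gamma> n = alpha_poles \<alpha> n" "\<gamma> (n - 1) = beta_poles \<alpha> (n - 1)"
    have p: "poly_at n ?p (\<gamma> (n - 1)) = b ^ n * (v * s * cnj h)"
      unfolding g(2) numer_poly_alpha_values[OF H g(1)] by (simp add: h_def a_def s_def b_def v_def)
    have d: "poly_at n (poly_star n ?p) (\<gamma> (n - 1)) = b ^ n * (cnj v * s * cnj c)"
      unfolding g(2) numer_poly_alpha_values[OF H g(1)] by (simp add: c_def a_def s_def b_def v_def)
    have "eta_param \<alpha> \<gamma> \<phi> n * (b ^ n * (v * s * cnj h) / cnj (b ^ n * (cnj v * s * cnj c)))
      = cnj (varsigma \<alpha> (n - 2)) * ((cnj b / b) ^ (n - 1) * (b ^ n / cnj b ^ n)) * (k / cnj k) * (cnj h / c)"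
      unfolding eta_b[OF g(2)] using s v by (simp add: mult_ac)
    also have "\<dots> = inverse (u * (cnj k / k) * (c / cnj h))"
      unfolding b_pow phase uu using u k h by (simp add: divide_inverse)
    finally show "lambda_param \<alpha> \<gamma> \<phi> n = einverse (Fin (reflection_coeff \<alpha> K H n))"
      unfolding lam R p d using s b h u k v by simp
  }
qed

end

context disk_poles
begin

text \<open>
  In the pure families one of the two dotted products is empty and the other is the full Blaschke
  product, so that both normalizations coincide with the mixed one.
\<close>

lemma orf_gamma_alpha:
  assumes "orf \<mu> \<alpha> (alpha_poles \<alpha>) \<phi>"
  shows "orf_gamma \<mu> \<alpha> (alpha_poles \<alpha>) \<phi>"
proof -
  have dot: "blaschke_dot \<alpha> (alpha_poles \<alpha>) (alpha_poles \<alpha>) n z = blaschke \<alpha> (alpha_poles \<alpha>) n z"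
    "blaschke_dot \<alpha> (alpha_poles \<alpha>) (beta_poles \<alpha>) n z = 1" for n z
    by (simp_all add: blaschke_dot_if blaschke_def alpha_poles_neq_beta_poles)
  have "blaschke_gamma \<alpha> (alpha_poles \<alpha>) = blaschke \<alpha> (alpha_poles \<alpha>)"
    by (intro ext) (simp add: blaschke_gamma_def dot)
  then show ?thesis
    using assms by (simp add: orf_def orf_gamma_def recip_gamma_def dot alpha_poles_neq_beta_poles)
qed

lemma orf_gamma_beta:
  assumes "orf \<mu> \<alpha> (beta_poles \<alpha>) \<phi>"
  shows "orf_gamma \<mu> \<alpha> (beta_poles \<alpha>) \<phi>"
proof -
  note neq = alpha_poles_neq_beta_poles[symmetric]
  have dot: "blaschke_dot \<alpha> (beta_poles \<alpha>) (beta_poles \<alpha>) n z = blaschke \<alpha> (beta_poles \<alpha>) n z"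
    "blaschke_dot \<alpha> (beta_poles \<alpha>) (alpha_poles \<alpha>) n z = 1" for n z
    by (simp_all add: blaschke_dot_if blaschke_def neq)
  have "blaschke_gamma \<alpha> (beta_poles \<alpha>) = blaschke \<alpha> (beta_poles \<alpha>)"
    by (intro ext) (simp add: blaschke_gamma_def dot neq)
  then show ?thesis
    using assms by (simp add: orf_def orf_gamma_def recip_gamma_def dot neq)
qed

end

lemma Fin_in_unit_disk: "cmod r < 1 \<Longrightarrow> Fin r \<in> unit_disk"
  by (simp add: unit_disk_def)

lemma einverse_in_exterior_disk:
  assumes "cmod r < 1"
  shows "einverse (Fin r) \<in> exterior_disk"
proof (cases "r = 0")
  case False
  then have "inverse (cmod r) > 1" using assms by (simp add: one_less_inverse)
  then show ?thesis using False
    by (auto simp: exterior_disk_def unit_disk_def unit_circle_def norm_inverse)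
qed (auto simp: exterior_disk_def unit_disk_def unit_circle_def)

theorem theorem5p3:
  fixes \<alpha> :: "nat \<Rightarrow> complex" and \<gamma> :: "nat \<Rightarrow> ecomplex" and \<mu> :: "complex measure"
    and \<phi>\<alpha> \<phi>\<beta> \<phi>\<gamma> :: "nat \<Rightarrow> complex \<Rightarrow> complex"
    and lam_alpha lam_beta lam :: "nat \<Rightarrow> ecomplex"
  assumes alpha0: "\<alpha> 0 = 0"
    and alpha: "\<And>j. j \<ge> 1 \<Longrightarrow> \<alpha> j \<in> ball 0 1"
    and gamma: "\<And>j. \<gamma> j \<in> {alpha_poles \<alpha> j, beta_poles \<alpha> j}"
    and measure: "positive_ae_prob_on_circle \<mu>"
    and phi_alpha: "orf \<mu> \<alpha> (alpha_poles \<alpha>) \<phi>\<alpha>"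
    and phi_beta: "orf \<mu> \<alpha> (beta_poles \<alpha>) \<phi>\<beta>"
    and phi_gamma: "orf_gamma \<mu> \<alpha> \<gamma> \<phi>\<gamma>"
  defines "lam_alpha \<equiv> lambda_param \<alpha> (alpha_poles \<alpha>) \<phi>\<alpha>"
    and "lam_beta \<equiv> lambda_param \<alpha> (beta_poles \<alpha>) \<phi>\<beta>"
    and "lam \<equiv> lambda_param \<alpha> \<gamma> \<phi>\<gamma>"
  shows "\<forall>n\<ge>1.
    (\<gamma> n = alpha_poles \<alpha> n \<and> \<gamma> (n - 1) = alpha_poles \<alpha> (n - 1) \<longrightarrow>
       lam n = lam_alpha n \<and> lam_alpha n = ecnj (lam_beta n) \<and> lam n \<in> unit_disk) \<and>
    (\<gamma> n = beta_poles \<alpha> n \<and> \<gamma> (n - 1) = beta_poles \<alpha> (n - 1) \<longrightarrow>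
       lam n = lam_beta n \<and> lam_beta n = ecnj (lam_alpha n) \<and> lam n \<in> unit_disk) \<and>
    (\<gamma> n = alpha_poles \<alpha> n \<and> \<gamma> (n - 1) = beta_poles \<alpha> (n - 1) \<longrightarrow>
       lam n = einverse (ecnj (lam_beta n)) \<and> einverse (ecnj (lam_beta n)) = einverse (lam_alpha n) \<and>
       lam n \<in> exterior_disk) \<and>
    (\<gamma> n = beta_poles \<alpha> n \<and> \<gamma> (n - 1) = alpha_poles \<alpha> (n - 1) \<longrightarrow>
       lam n = einverse (ecnj (lam_alpha n)) \<and> einverse (ecnj (lam_alpha n)) = einverse (lam_beta n) \<and>
       lam n \<in> exterior_disk)"
proof (intro allI impI)
  fix n :: nat
  assume n: "n \<ge> 1"
  have disk: "cmod (\<alpha> j) < 1" for j using alpha0 alpha[of j] by (cases "j = 0") auto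
  interpret A: mixed_orf \<mu> \<alpha> "alpha_poles \<alpha>" \<phi>\<alpha>
  proof -
    interpret disk_poles \<mu> \<alpha> by unfold_locales (use measure disk alpha0 in auto)
    show "mixed_orf \<mu> \<alpha> (alpha_poles \<alpha>) \<phi>\<alpha>"
      by unfold_locales (use orf_gamma_alpha[OF phi_alpha] in auto)
  qed
  interpret B: mixed_orf \<mu> \<alpha> "beta_poles \<alpha>" \<phi>\<beta>
    by unfold_locales (use A.orf_gamma_beta[OF phi_beta] in auto)
  interpret G: mixed_orf \<mu> \<alpha> \<gamma> \<phi>\<gamma>
    by unfold_locales (use gamma phi_gamma in auto)
  define K where "K = A.kernel_poly (n - 1)"
  define H where "H = A.kernel_poly n"
  define r where "r = reflection_coeff \<alpha> K H n"
  have KH: "szego_kernel \<mu> \<alpha> (n - 1) K" "szego_kernel \<mu> \<alpha> n H"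
    unfolding K_def H_def by (rule A.szego_kernel_kernel_poly)+
  have r: "cmod r < 1" "cmod (cnj r) < 1"
    using A.norm_reflection_coeff[OF KH n] by (simp_all add: r_def)
  \<comment> \<open>The kernel polynomials depend on \<open>\<mu>\<close> and \<open>\<alpha>\<close> alone, so all three families share the number \<open>r\<close>.\<close>
  have la: "lam_alpha n = Fin r" and lb: "lam_beta n = Fin (cnj r)"
    unfolding lam_alpha_def lam_beta_def r_def
    using A.lambda_param_cases(1)[OF n KH] B.lambda_param_cases(2)[OF n KH] by simp_all
  note lg = G.lambda_param_cases[OF n KH, folded r_def lam_def]
  show "(\<gamma> n = alpha_poles \<alpha> n \<and> \<gamma> (n - 1) = alpha_poles \<alpha> (n - 1) \<longrightarrow>
       lam n = lam_alpha n \<and> lam_alpha n = ecnj (lam_beta n) \<and> lam n \<in> unit_disk) \<and>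
    (\<gamma> n = beta_poles \<alpha> n \<and> \<gamma> (n - 1) = beta_poles \<alpha> (n - 1) \<longrightarrow>
       lam n = lam_beta n \<and> lam_beta n = ecnj (lam_alpha n) \<and> lam n \<in> unit_disk) \<and>
    (\<gamma> n = alpha_poles \<alpha> n \<and> \<gamma> (n - 1) = beta_poles \<alpha> (n - 1) \<longrightarrow>
       lam n = einverse (ecnj (lam_beta n)) \<and> einverse (ecnj (lam_beta n)) = einverse (lam_alpha n) \<and>
       lam n \<in> exterior_disk) \<and>
    (\<gamma> n = beta_poles \<alpha> n \<and> \<gamma> (n - 1) = alpha_poles \<alpha> (n - 1) \<longrightarrow>
       lam n = einverse (ecnj (lam_alpha n)) \<and> einverse (ecnj (lam_alpha n)) = einverse (lam_beta n) \<and>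
       lam n \<in> exterior_disk)"
    using lg einverse_in_exterior_disk[OF r(1)] einverse_in_exterior_disk[OF r(2)]
      Fin_in_unit_disk[OF r(1)] Fin_in_unit_disk[OF r(2)]
    unfolding la lb ecnj.simps complex_cnj_cnj by metis
qed

end
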